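(* Let $n\ge 1$, let $V\colon S^{2n+1}\to US^{2n+1}$ be the cross-section of the unit tangent bundle given by a Hopf vector field on $S^{2n+1}$, and let $i\colon V(S^{2n+1})\to US^{2n+1}$ be the inclusion of its image. Then every map $f\colon V(S^{2n+1})\to US^{2n+1}$ which is homotopic to $i$ has Lipschitz constant $\operatorname{Lip} f\ge 1$, and $\operatorname{Lip} f=1$ if and only if $f$ is isometric to the inclusion $i$.
   Context: $S^{m}$ is the round $m$-sphere of radius $1$. Its unit tangent bundle is $US^{m}=\{(x,y)\in S^m\times S^m: x\cdot y=0\}$, with the Riemannian metric induced by its inclusion in $S^m\times S^m$ with the product metric (not the Sasaki metric). The submanifold $V(S^{2n+1})\subset US^{2n+1}$ carries the induced Riemannian metric (it is a round sphere of radius $\sqrt2$). Riemannian manifolds are regarded as metric spaces with their geodesic distance. Maps are continuous. Hopf vector fields. Given a Hopf fibration of $S^{2n+1}$ by parallel great circles (the intersections of $S^{2n+1}$ with the complex lines through the origin for some orthogonal complex structure on $\mathbb{R}^{2n+2}$), let $v$ be either of the two unit vector fields on $S^{2n+1}$ tangent to the fibres, and set $V(x)=(x,v(x))$. Equivalently, $v$ is the restriction to $S^{2n+1}$ of some $J\in SO(2n+2)$ with $J^2=-\mathrm{Identity}$. For a continuous map $f\colon X\to Y$ of metric spaces, $\operatorname{Lip} f$ is the smallest $c\ge 0$ such that $d(f(x),f(x'))\le c\,d(x,x')$ for all $x,x'\in X$ (and $\infty$ if no such $c$ exists). Two maps $f_1,f_2\colon X\to Y$ between metric spaces are isometric if there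 are isometries $g_X\colon X\to X$ and $g_Y\colon Y\to Y$ (from each space onto itself) with $g_Y f_1=f_2 g_X$. *)

theory Defs
  imports "HOL-Analysis.Analysis"
begin

definition unit_tangent_bundle :: "('a::real_inner \<times> 'a) set" where
  "unit_tangent_bundle = {(x, y). norm x = 1 \<and> norm y = 1 \<and> x \<bullet> y = 0}"

definition hopf_vector_field :: "(real^'k \<Rightarrow> real^'k) \<Rightarrow> bool" where
  "hopf_vector_field v \<longleftrightarrow>
     (\<exists>J::real^'k^'k. rotation_matrix J \<and> J ** J = - mat 1 \<and> (\<forall>x\<in>sphere 0 1. v x = J *v x))"

definition vector_field_section :: "('a \<Rightarrow> 'a) \<Rightarrow> 'a \<Rightarrow> 'a \<times> 'a" where
  "vector_field_section v x = (x, v x)"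

text \<open>
  The geodesic distance of a submanifold \<open>S\<close> of a Euclidean space with the induced Riemannian
  metric: the infimum of the lengths of the piecewise continuously differentiable curves
  in \<open>S\<close>. The norm on a product type is the Euclidean one, so on a submanifold of
  \<open>'a \<times> 'a\<close> this is the metric induced by the product metric.

  The predicate \<^const>\<open>valid_path\<close> bounds neither the derivative near the exceptional points
  nor the length of the curve. Writing the length with \<open>has_integral\<close> discards the curves of
  infinite length, to which the operator \<open>integral\<close> would assign the value 0.

  The value is meaningful only if some piecewise continuously differentiable curve of finite
  length in \<open>S\<close> joins the two points; otherwise it is an infimum over the empty set.
\<close>
definition geodesic_dist :: "'a::euclidean_space set \<Rightarrow> 'a \<Rightarrow> 'a \<Rightarrow> real" where
  "geodesic_dist S x y =
     Inf {L. \<exists>\<gamma>. valid_path \<gamma> \<and> path_image \<gamma> \<subseteq> S \<and> pathstart \<gamma> = x \<and> pathfinish \<gamma> = y \<and>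
              ((\<lambda>t. norm (vector_derivative \<gamma> (at t))) has_integral L) {0..1}}"

text \<open>
  A metric space is given by a carrier and a distance function. The infimum over the empty
  set is \<open>\<infinity>\<close>, and the infimum over a nonempty set of Lipschitz constants is attained.
\<close>
definition Lip :: "'a set \<Rightarrow> ('a \<Rightarrow> 'a \<Rightarrow> real) \<Rightarrow> ('b \<Rightarrow> 'b \<Rightarrow> real) \<Rightarrow> ('a \<Rightarrow> 'b) \<Rightarrow> ereal" where
  "Lip X dX dY f =
     Inf {ereal c | c. 0 \<le> c \<and> (\<forall>x\<in>X. \<forall>x'\<in>X. dY (f x) (f x') \<le> c * dX x x')}"

definition self_isometry :: "'a set \<Rightarrow> ('a \<Rightarrow> 'a \<Rightarrow> real) \<Rightarrow> ('a \<Rightarrow> 'a) \<Rightarrow> bool" where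
  "self_isometry X d g \<longleftrightarrow> bij_betw g X X \<and> (\<forall>x\<in>X. \<forall>y\<in>X. d (g x) (g y) = d x y)"

definition isometric_maps ::
  "'a set \<Rightarrow> ('a \<Rightarrow> 'a \<Rightarrow> real) \<Rightarrow> 'b set \<Rightarrow> ('b \<Rightarrow> 'b \<Rightarrow> real) \<Rightarrow> ('a \<Rightarrow> 'b) \<Rightarrow> ('a \<Rightarrow> 'b) \<Rightarrow> bool" where
  "isometric_maps X dX Y dY f1 f2 \<longleftrightarrow>
     (\<exists>gX gY. self_isometry X dX gX \<and> self_isometry Y dY gY \<and> (\<forall>x\<in>X. gY (f1 x) = f2 (gX x)))"

end

theory Submission
  imports Defs "HOL-Homology.Homology"
begin

text \<open>
  Let \<open>J\<close> be the complex structure of the Hopf field and write \<open>f (x, J x) = (g\<^sub>1 x, g\<^sub>2 x)\<close>. Then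
  \<open>g\<^sub>1 x\<close> and \<open>g\<^sub>2 x\<close> are orthogonal unit vectors, and both \<open>g\<^sub>1\<close> and \<open>g\<^sub>2\<close> are homotopic to the
  identity of the sphere. Distances in the unit tangent bundle are bounded below by the Pythagorean
  sum of the two angles, whereas the image of the Hopf section is a round sphere of radius
  \<open>\<surd>2\<close>. A Lipschitz constant \<open>c\<close> of \<open>f\<close> therefore satisfies
  \<open>\<angle>(g\<^sub>1 x, g\<^sub>1 y)\<^sup>2 + \<angle>(g\<^sub>2 x, g\<^sub>2 y)\<^sup>2 \<le> 2 (c \<angle>(x, y))\<^sup>2\<close>,
  and everything is read off from this inequality.

  For the lower bound, some \<open>p\<close> has \<open>g\<^sub>1 (- p) = - g\<^sub>1 p\<close>: otherwise normalising \<open>g\<^sub>1 x + g\<^sub>1 (- x)\<close>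
  gives an even map that is homotopic to the identity, although an even map has even degree
  (\<open>even_degree_if_invariant\<close>, \<open>exists_opposite_values_on_involution_orbit\<close>). As \<open>g\<^sub>2\<close> is onto, some \<open>q\<close>
  has \<open>g\<^sub>2 q = g\<^sub>1 p\<close>. The vectors \<open>g\<^sub>1 q\<close> and \<open>g\<^sub>2 (\<plusminus>p)\<close> are orthogonal to this common value, so all four
  angles between the images of \<open>q\<close> and of \<open>\<plusminus>p\<close> are right angles. Hence \<open>c \<angle>(p, q)\<close> and
  \<open>c \<angle>(- p, q)\<close> are both at least \<open>\<pi>/2\<close>; since the two angles add up to \<open>\<pi>\<close>, \<open>c \<ge> 1\<close>
  (\<open>Lipschitz_constant_ge_one\<close>).

  Now let \<open>c = 1\<close>. In the situation just described the quarter circle from \<open>p\<close> to \<open>q\<close> must go to a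
  pair of quarter circles (\<open>geodesic_rigid\<close>), and the orthogonality of \<open>g\<^sub>1\<close> and \<open>g\<^sub>2\<close> along them forces
  \<open>g\<^sub>1 q = - g\<^sub>2 p\<close>. So \<open>g\<^sub>1\<close> and \<open>g\<^sub>2\<close> are linear on the plane of \<open>p\<close> and \<open>q\<close> (\<open>antipodal_circle\<close>). The
  orthogonal complement of this plane goes into the orthogonal complement of its image
  (\<open>images_orthogonal\<close>), and \<open>g\<^sub>1\<close>, \<open>g\<^sub>2\<close> are the joins of their restrictions (\<open>radial_add\<close>). The same
  argument applies inside the complement, with the antipodal map replaced by the involution that is \<open>-1\<close>
  on the complement and \<open>1\<close> on the plane; plane after plane (\<open>linear_part_extend\<close>) it yields
  \<open>f (x, J x) = (A x, A (K x))\<close> with \<open>A\<close> orthogonal and \<open>K\<close> an orthogonal complex structure. Two such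
  structures \<open>K\<close> and \<open>J\<close> are conjugate by an orthogonal \<open>C\<close>, and \<open>C\<close> together with \<open>C \<circ> A\<^sup>-\<^sup>1\<close>
  provides the isometries that carry \<open>f\<close> to the inclusion.

  Conversely the inclusion is distance nonincreasing, because curves in the image of the section are curves
  in the unit tangent bundle; so is every map isometric to it.
\<close>

section \<open>Maps of spheres invariant under an involution\<close>

text \<open>
  Cut the sphere along the equator into the hemispheres \<open>P\<close> and \<open>N\<close>. Modulo the equator the fundamental
  class is \<open>a + b\<close> with \<open>a\<close> supported in \<open>P\<close> and \<open>b\<close> in \<open>N\<close>. As \<open>\<tau>\<close> is homotopic to the
  identity it preserves this class, and as it exchanges the hemispheres it sends \<open>b\<close> to \<open>a\<close>. By
  \<open>F \<circ> \<tau> = F\<close> the classes \<open>a\<close> and \<open>b\<close> have the same image under \<open>F\<close>, so the image of the fundamental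
  class is twice something modulo \<open>A\<close>. As \<open>A\<close> is contractible, nothing is lost by passing to the quotient.
\<close>
lemma even_degree_if_invariant:
  assumes contF: "continuous_map (nsphere n) (nsphere n) F"
    and tau_id: "homotopic_with (\<lambda>_. True) (nsphere n) (nsphere n) \<tau> id"
    and tau_flip: "\<And>x. x \<in> topspace (nsphere n) \<Longrightarrow> \<tau> x n = - x n"
    and F_tau: "\<And>x. x \<in> topspace (nsphere n) \<Longrightarrow> F (\<tau> x) = F x"
    and F_eq: "\<And>x. x \<in> topspace (nsphere n) \<Longrightarrow> x n = 0 \<Longrightarrow> F x \<in> A"
    and A: "contractible_space (subtopology (nsphere n) A)" "topspace (nsphere n) \<inter> A \<noteq> {}"
  shows "even (Brouwer_degree2 n F)"
proof -
  define S where "S = nsphere n"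
  define E where "E = {x::nat\<Rightarrow>real. x n = 0}"
  define P where "P = {x::nat\<Rightarrow>real. x n \<ge> 0}"
  define N where "N = {x::nat\<Rightarrow>real. x n \<le> 0}"
  obtain a0 where a0: "a0 \<in> topspace S" "a0 \<in> A" using A(2) by (auto simp: S_def)
  \<comment> \<open>The maps are extended off the sphere so that the inclusions between the half spaces
    and the equator hold for all arguments, as functoriality of relative homology demands.\<close>
  define t where "t x = (if x \<in> topspace S then \<tau> x else (\<lambda>i. - x i))" for x
  define G where "G x = (if x \<in> topspace S then F x else a0)" for x
  have cont_t: "continuous_map S S t"
    using homotopic_with_imp_continuous_maps[OF tau_id] unfolding S_def
    by (auto intro: continuous_map_eq simp: t_def S_def)
  have cont_G: "continuous_map S S G"
    using contF unfolding S_def by (rule continuous_map_eq) (auto simp: G_def S_def)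
  have t_flip: "t x n = - x n" for x
    using tau_flip by (simp add: t_def S_def)
  have [simp]: "t \<in> E \<rightarrow> E" "t \<in> P \<rightarrow> N" "t \<in> N \<rightarrow> P" "id \<in> E \<rightarrow> P" "id \<in> E \<rightarrow> N" "E \<subseteq> P" "E \<subseteq> N"
    by (auto simp: E_def P_def N_def t_flip)
  have [simp]: "G \<in> E \<rightarrow> A"
    using F_eq a0 by (auto simp: E_def G_def S_def)
  have [simp]: "t x \<in> topspace S" if "x \<in> topspace S" for x
    using continuous_map_image_subset_topspace[OF cont_t] that by auto
  have G_t: "G (t x) = G x" if "x \<in> topspace S" for x
    using that F_tau by (auto simp: G_def S_def t_def) (metis S_def \<open>\<And>x. x \<in> topspace S \<Longrightarrow> t x \<in> topspace S\<close> t_def)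
  have [simp]: "continuous_map (subtopology S X) S f" if "continuous_map S S f" for X f
    using that by (simp add: continuous_map_from_subtopology)
  have [simp]: "continuous_map S S t" "continuous_map S S G" by fact+
  have [simp]: "continuous_map (subtopology S P) (subtopology S N) t"
    "continuous_map (subtopology S N) (subtopology S P) t"
    by (auto simp: continuous_map_in_subtopology P_def N_def t_flip)
  define R where "R = reduced_homology_group n S"
  define H where "H X = relative_homology_group n S X" for X
  define HP where "HP = relative_homology_group n (subtopology S P) E"
  define HN where "HN = relative_homology_group n (subtopology S N) E"
  define h where "h X Y f = hom_induced n S X S Y f" for X Y f
  define iP where "iP = hom_induced n (subtopology S P) E S E id"
  define iN where "iN = hom_induced n (subtopology S N) E S E id"
  define tN where "tN = hom_induced n (subtopology S N) E (subtopology S P) E t"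
  define tP where "tP = hom_induced n (subtopology S P) E (subtopology S N) E t"
  interpret HE: comm_group "H E" by (simp add: H_def)
  interpret HA: comm_group "H A" by (simp add: H_def)
  interpret HL: comm_group "H N" by (simp add: H_def)
  interpret R: group R by (simp add: R_def)
  interpret hEN: group_hom "H E" "H N" "h E N id"
    by (simp add: group_hom_axioms_def group_hom_def h_def H_def hom_induced_hom)
  interpret hEE: group_hom "H E" "H E" "h E E t"
    by (simp add: group_hom_axioms_def group_hom_def h_def H_def hom_induced_hom)
  interpret hEA: group_hom "H E" "H A" "h E A G"
    by (simp add: group_hom_axioms_def group_hom_def h_def H_def hom_induced_hom)
  have k_iso: "h {} A id \<in> iso R (H A)"
    unfolding h_def H_def R_def S_def by (rule iso_reduced_homology_by_contractible[OF A])
  interpret k: group_hom R "H A" "h {} A id"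
    using k_iso by (simp add: group_hom_axioms_def group_hom_def Group.iso_def R.is_group HA.is_group)
  \<comment> \<open>\<open>z\<close> is the fundamental class and \<open>y\<close> its image modulo the equator.\<close>
  obtain z where z: "z \<in> carrier R" "subgroup_generated R {z} = R"
    using cyclic_reduced_homology_group_nsphere[of n n] by (auto simp: cyclic_group_def R_def S_def)
  have z': "z \<in> carrier (homology_group n S)"
    using z(1) carrier_reduced_homology_group_subset by (auto simp: R_def)
  define y where "y = h {} E id z"
  have y: "y \<in> carrier (H E)" by (simp add: y_def h_def H_def hom_induced_carrier)
  have hP_iso: "hom_induced n (subtopology S P) E S N id \<in> iso HP (H N)"
    using iso_relative_homology_group_upper_hemisphere[of n n n]
    by (simp add: S_def P_def E_def N_def HP_def H_def)
  have comp_P: "h E N id (iP c) = hom_induced n (subtopology S P) E S N id c" for c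
    unfolding h_def iP_def by (subst hom_induced_compose') auto
  have "h {} N id z \<in> carrier (H N)" by (simp add: h_def H_def hom_induced_carrier)
  \<comment> \<open>Excision: modulo \<open>N\<close> the class \<open>z\<close> comes from a unique class of \<open>P\<close> modulo the equator.\<close>
  then obtain a where a: "a \<in> carrier HP" "h E N id (iP a) = h {} N id z"
    using hP_iso unfolding comp_P iso_iff by (metis imageE)
  have iPc [simp]: "iP c \<in> carrier (H E)" and iNc [simp]: "iN c \<in> carrier (H E)" for c
    by (simp_all add: iP_def iN_def H_def hom_induced_carrier)
  have hENy: "h E N id y = h {} N id z"
    unfolding y_def h_def by (subst hom_induced_compose') auto
  have ex: "kernel (H E) (H N) (h E N id) = iN ` carrier HN"
    using homology_exactness_triple_3[OF \<open>E \<subseteq> N\<close>, of n S]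
    by (simp add: H_def h_def iN_def HN_def)
  have "y \<otimes>\<^bsub>H E\<^esub> inv\<^bsub>H E\<^esub> (iP a) \<in> kernel (H E) (H N) (h E N id)"
    using y a hENy hEN.hom_closed[OF y] by (simp add: kernel_def)
  \<comment> \<open>Exactness of the triple (sphere, \<open>N\<close>, equator): what remains of \<open>y\<close> comes from \<open>N\<close>.\<close>
  then obtain b where b: "b \<in> carrier HN" "y \<otimes>\<^bsub>H E\<^esub> inv\<^bsub>H E\<^esub> (iP a) = iN b"
    unfolding ex by blast
  have y_eq: "y = iN b \<otimes>\<^bsub>H E\<^esub> iP a"
    using b(2) y by (metis HE.inv_closed HE.m_assoc HE.l_inv HE.r_one iPc)
  \<comment> \<open>The involution fixes \<open>z\<close>, hence \<open>y\<close>; comparing the parts in \<open>P\<close> gives \<open>a = t\<^sub>* b\<close>.\<close>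
  have tz: "h {} {} t z = z"
  proof -
    have "homotopic_with (\<lambda>_. True) S S t id"
      by (rule homotopic_with_eq[OF tau_id[folded S_def]]) (auto simp: t_def)
    then have "h {} {} t = h {} {} id" unfolding h_def by (rule homology_homotopy_empty)
    then show ?thesis using hom_induced_id[OF z'] by (simp add: h_def)
  qed
  have ty: "h E E t y = y"
  proof -
    have "h E E t y = h {} E t z" unfolding y_def h_def by (subst hom_induced_compose') auto
    also have "\<dots> = h {} E id (h {} {} t z)" unfolding h_def by (subst hom_induced_compose') auto
    finally show ?thesis by (simp add: tz y_def)
  qed
  have ti: "h E E t (iP c) = iN (tP c)" "h E E t (iN d) = iP (tN d)" for c d
    unfolding h_def iP_def iN_def tP_def tN_def by (subst (1 2) hom_induced_compose'; auto)+
  have iN0: "h E N id (iN d) = \<one>\<^bsub>H N\<^esub>" if "d \<in> carrier HN" for d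
    using ex that by (auto simp: kernel_def)
  have tPc: "tP c \<in> carrier HN" and tNc: "tN d \<in> carrier HP" for c d
    by (simp_all add: tP_def tN_def HP_def HN_def hom_induced_carrier)
  have y_eq2: "y = iP (tN b) \<otimes>\<^bsub>H E\<^esub> iN (tP a)"
    using ty unfolding y_eq by (simp add: ti)
  have "h E N id (iP a) = h E N id y" using a hENy by simp
  also have "\<dots> = h E N id (iP (tN b))"
    unfolding y_eq2 by (simp add: iN0 tPc)
  finally have "a = tN b"
    unfolding comp_P using hP_iso a tNc by (auto simp: iso_iff inj_on_def)
  \<comment> \<open>Both parts of \<open>y\<close> have the same image \<open>w\<close> under \<open>F\<close>.\<close>
  define w where "w = h E A G (iN b)"
  have wc: "w \<in> carrier (H A)" by (simp add: w_def h_def H_def hom_induced_carrier)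
  have "h E A G (iP a) = hom_induced n (subtopology S N) E S A (G \<circ> t) b"
    unfolding \<open>a = tN b\<close> iP_def tN_def h_def
    by (subst hom_induced_compose' | simp)+
  also have "hom_induced n (subtopology S N) E S A (G \<circ> t) = hom_induced n (subtopology S N) E S A G"
    by (rule hom_induced_eq) (auto simp: G_t)
  also have "\<dots> b = w"
    unfolding w_def iN_def h_def by (subst hom_induced_compose') auto
  finally have "h E A G y = w \<otimes>\<^bsub>H A\<^esub> w"
    unfolding y_eq by (simp add: w_def)
  moreover have "h E A G y = h {} A id (h {} {} G z)"
    unfolding y_def h_def by (subst (1 2) hom_induced_compose') auto
  moreover have "h {} {} G z = z [^]\<^bsub>R\<^esub> Brouwer_degree2 n F"
  proof -
    have "Brouwer_degree2 n F = Brouwer_degree2 n G"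
      by (rule Brouwer_degree2_eq) (auto simp: G_def S_def)
    then show ?thesis using Brouwer_degree2[of z n G] z(1) by (simp add: h_def R_def S_def)
  qed
  ultimately have kd: "h {} A id (z [^]\<^bsub>R\<^esub> Brouwer_degree2 n F) = w \<otimes>\<^bsub>H A\<^esub> w" by simp
  obtain u where u: "u \<in> carrier R" "w = h {} A id u"
    using k_iso wc by (auto simp: iso_iff)
  obtain m :: int where m: "u = z [^]\<^bsub>R\<^esub> m"
    using u(1) R.carrier_subgroup_generated_by_singleton[OF z(1)] by (auto simp: z(2))
  have "h {} A id (z [^]\<^bsub>R\<^esub> Brouwer_degree2 n F) = h {} A id (z [^]\<^bsub>R\<^esub> (m + m))"
    using R.int_pow_mult[OF z(1), of m m] k.hom_mult[of u u] u by (simp only: kd m)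
  then have "z [^]\<^bsub>R\<^esub> Brouwer_degree2 n F = z [^]\<^bsub>R\<^esub> (m + m)"
    using k_iso z(1) by (auto simp: iso_iff inj_on_def)
  moreover have "R.ord z = 0"
    using z unfolding R_def S_def
    by (metis R.infinite_cyclic_subgroup_order R_def S_def infinite_UNIV_int iso_finite
        reduced_homology_group_nsphere(1) carrier_integer_group)
  ultimately have "Brouwer_degree2 n F = m + m"
    using z(1) by (simp add: R.int_pow_eq)
  then show ?thesis by simp
qed

text \<open>
  Coordinates with respect to an orthonormal basis whose last vector is \<open>e\<close>. The hemispheres of the
  model sphere \<open>nsphere\<close> are defined by its last coordinate.
\<close>
lemma homeomorphic_nsphere_last_coordinate:
  fixes e :: "'a::euclidean_space"
  assumes e: "norm e = 1"
  obtains \<phi> :: "(nat \<Rightarrow> real) \<Rightarrow> 'a" and \<beta>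
  where "homeomorphic_maps (nsphere (DIM('a) - 1)) (top_of_set (sphere 0 1)) \<phi> \<beta>"
    and "\<And>x. \<beta> x (DIM('a) - 1) = x \<bullet> e"
proof -
  define m where "m = DIM('a) - 1"
  have m: "DIM('a) = Suc m" by (simp add: m_def)
  obtain B where B: "e \<in> B" "pairwise orthogonal B" "\<And>x. x \<in> B \<Longrightarrow> norm x = 1"
    "independent B" "card B = DIM('a)" "span B = UNIV"
    using vector_in_orthonormal_basis[OF e] by metis
  have "finite B" using B(5) by (metis DIM_positive card.infinite less_irrefl)
  then have "card (B - {e}) = m" using B m by simp
  then obtain h where h: "bij_betw h {..<m} (B - {e})"
    using ex_bij_betw_nat_finite[of "B - {e}"] \<open>finite B\<close> by (auto simp: atLeast0LessThan)
  define b where "b i = (if i = m then e else h i)" for i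
  have bB: "bij_betw b {..m} B"
  proof -
    have "bij_betw b {..<m} (B - {e})"
      by (rule iffD1[OF bij_betw_cong h]) (auto simp: b_def)
    moreover have "bij_betw b {m} {e}" by (auto simp: b_def bij_betw_def)
    ultimately have "bij_betw b ({..<m} \<union> {m}) ((B - {e}) \<union> {e})"
      by (rule bij_betw_combine) auto
    moreover have "{..<m} \<union> {m} = {..m}" "(B - {e}) \<union> {e} = B" using B(1) by auto
    ultimately show ?thesis by simp
  qed
  have orth: "b i \<bullet> b j = (if i = j then 1 else 0)" if "i \<le> m" "j \<le> m" for i j
  proof (cases "i = j")
    case True
    then show ?thesis using that B(3)[of "b i"] bB by (auto simp: bij_betw_def dot_square_norm)
  next
    case False
    then have "b i \<noteq> b j" using bB that by (auto simp: bij_betw_def inj_on_def)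
    then show ?thesis using False that B(2) bB
      by (auto simp: pairwise_def orthogonal_def bij_betw_def)
  qed
  define \<phi> where "\<phi> x = (\<Sum>i\<le>m. x i *\<^sub>R b i)" for x :: "nat \<Rightarrow> real"
  define \<beta> where "\<beta> v i = (if i \<le> m then v \<bullet> b i else 0)" for v i
  have norm_phi: "\<phi> x \<bullet> \<phi> x = (\<Sum>i\<le>m. (x i)\<^sup>2)" for x
    unfolding \<phi>_def
    by (simp add: inner_sum_left inner_sum_right orth if_distrib power2_eq_square cong: if_cong)
  have phi_beta: "\<phi> (\<beta> v) = v" for v
  proof -
    have "\<phi> (\<beta> v) = (\<Sum>i\<le>m. (v \<bullet> b i) *\<^sub>R b i)" by (simp add: \<phi>_def \<beta>_def)
    also have "\<dots> = (\<Sum>u\<in>B. (v \<bullet> u) *\<^sub>R u)" by (rule sum.reindex_bij_betw[OF bB])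
    also have "\<dots> = v"
    proof -
      have "orthogonal (v - (\<Sum>u\<in>B. (v \<bullet> u) *\<^sub>R u)) w" if "w \<in> B" for w
      proof -
        have "(\<Sum>u\<in>B. (v \<bullet> u) * (u \<bullet> w)) = (\<Sum>u\<in>B. if u = w then v \<bullet> w else 0)"
          using B(2,3) that by (intro sum.cong) (auto simp: pairwise_def orthogonal_def dot_square_norm)
        then show ?thesis
          using that \<open>finite B\<close> by (simp add: orthogonal_def inner_diff_left inner_sum_left)
      qed
      then have "orthogonal (v - (\<Sum>u\<in>B. (v \<bullet> u) *\<^sub>R u)) (v - (\<Sum>u\<in>B. (v \<bullet> u) *\<^sub>R u))"
        using orthogonal_to_span[of _ B] B(6) by blast
      then show ?thesis by (simp add: orthogonal_self)
    qed
    finally show ?thesis .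
  qed
  have beta_phi: "\<beta> (\<phi> x) = x" if "\<forall>i>m. x i = 0" for x
  proof
    fix j show "\<beta> (\<phi> x) j = x j"
      using that unfolding \<phi>_def \<beta>_def
      by (auto simp: inner_sum_left orth if_distrib cong: if_cong)
  qed
  have norm_beta: "(\<Sum>i\<le>m. (\<beta> v i)\<^sup>2) = v \<bullet> v" for v
    using norm_phi[of "\<beta> v"] by (simp add: phi_beta)
  have top: "topspace (nsphere m) = {x. (\<Sum>i\<le>m. (x i)\<^sup>2) = 1 \<and> (\<forall>i>m. x i = 0)}"
    by (simp add: nsphere)
  have "continuous_on UNIV \<phi>"
    unfolding \<phi>_def by (intro continuous_intros continuous_on_product_coordinates)
  then have "continuous_map (nsphere m) euclidean \<phi>"
    unfolding nsphere by (intro continuous_map_from_subtopology) (simp add: euclidean_product_topology)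
  moreover have "continuous_map euclidean (powertop_real UNIV) \<beta>"
    unfolding continuous_map_componentwise_UNIV \<beta>_def by (auto intro!: continuous_intros)
  ultimately have "homeomorphic_maps (nsphere m) (top_of_set (sphere 0 1)) \<phi> \<beta>"
    unfolding homeomorphic_maps_def
    using norm_phi norm_beta beta_phi phi_beta
    by (auto simp: continuous_map_in_subtopology top nsphere norm_eq_1 \<beta>_def
        simp del: continuous_map_iff_continuous2 intro: continuous_map_from_subtopology)
  moreover have "\<beta> x m = x \<bullet> e" for x by (simp add: \<beta>_def b_def)
  ultimately show thesis using that[of \<phi> \<beta>] by (simp add: m_def)
qed

text \<open>
  The parity of the degree, in coordinates: the identity has degree 1, which is odd. The complement of the
  missed point \<open>q\<close> serves as the contractible set that contains the image of the equator.
\<close>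
lemma invariant_map_not_homotopic_to_id:
  fixes F \<tau> :: "'a::euclidean_space \<Rightarrow> 'a"
  assumes contF: "continuous_on (sphere 0 1) F" and Fim: "F ` sphere 0 1 \<subseteq> sphere 0 1"
    and tau_id: "homotopic_with_canon (\<lambda>_. True) (sphere 0 1) (sphere 0 1) \<tau> id"
    and e: "norm e = 1" and tau_e: "\<And>x. \<tau> x \<bullet> e = - (x \<bullet> e)"
    and F_tau: "\<And>x. norm x = 1 \<Longrightarrow> F (\<tau> x) = F x"
    and q: "norm q = 1" "\<And>x. norm x = 1 \<Longrightarrow> x \<bullet> e = 0 \<Longrightarrow> F x \<noteq> q"
  shows "\<not> homotopic_with_canon (\<lambda>_. True) (sphere 0 1) (sphere 0 1) F id"
proof
  assume hom: "homotopic_with_canon (\<lambda>_. True) (sphere 0 1) (sphere 0 1) F id"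
  define m where "m = DIM('a) - 1"
  obtain \<phi> :: "(nat \<Rightarrow> real) \<Rightarrow> 'a" and \<beta>
    where hm: "homeomorphic_maps (nsphere m) (top_of_set (sphere 0 1)) \<phi> \<beta>"
      and last: "\<And>x. \<beta> x m = x \<bullet> e"
    using homeomorphic_nsphere_last_coordinate[OF e] unfolding m_def by metis
  have c\<phi>: "continuous_map (nsphere m) (top_of_set (sphere 0 1)) \<phi>"
    and c\<beta>: "continuous_map (top_of_set (sphere 0 1)) (nsphere m) \<beta>"
    and \<beta>\<phi>: "\<And>x. x \<in> topspace (nsphere m) \<Longrightarrow> \<beta> (\<phi> x) = x"
    and \<phi>\<beta>: "\<And>x. norm x = 1 \<Longrightarrow> \<phi> (\<beta> x) = x"
    using hm by (auto simp: homeomorphic_maps_def)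
  have \<phi>1: "norm (\<phi> x) = 1" if "x \<in> topspace (nsphere m)" for x
    using continuous_map_image_subset_topspace[OF c\<phi>] that by auto
  have \<beta>1: "\<beta> x \<in> topspace (nsphere m)" if "norm x = 1" for x
    using continuous_map_image_subset_topspace[OF c\<beta>] that by auto
  have \<tau>1: "norm (\<tau> x) = 1" if "norm x = 1" for x
    using homotopic_with_imp_subset1[OF tau_id] that by (auto simp: image_subset_iff)
  have F1: "norm (F x) = 1" if "norm x = 1" for x
    using Fim that by (auto simp: image_subset_iff)
  have trans: "homotopic_with (\<lambda>_. True) (nsphere m) (nsphere m) (\<beta> \<circ> (f \<circ> \<phi>)) id"
    if "homotopic_with_canon (\<lambda>_. True) (sphere 0 1) (sphere 0 1) f id" for f
  proof -
    have "homotopic_with (\<lambda>_. True) (nsphere m) (top_of_set (sphere 0 1)) (f \<circ> \<phi>) (id \<circ> \<phi>)"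
      by (rule homotopic_with_compose_continuous_map_right[OF that c\<phi>]) auto
    then have "homotopic_with (\<lambda>_. True) (nsphere m) (nsphere m) (\<beta> \<circ> (f \<circ> \<phi>)) (\<beta> \<circ> (id \<circ> \<phi>))"
      by (rule homotopic_with_compose_continuous_map_left[OF _ c\<beta>]) auto
    then show ?thesis by (rule homotopic_with_eq) (auto simp: \<beta>\<phi>)
  qed
  define A where "A = topspace (nsphere m) - {\<beta> q}"
  have "even (Brouwer_degree2 m (\<beta> \<circ> (F \<circ> \<phi>)))"
  proof (rule even_degree_if_invariant[OF _ trans[OF tau_id]])
    show "continuous_map (nsphere m) (nsphere m) (\<beta> \<circ> (F \<circ> \<phi>))"
      using homotopic_with_imp_continuous_maps[OF trans[OF hom]] by auto
    fix x assume x: "x \<in> topspace (nsphere m)"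
    show "(\<beta> \<circ> (\<tau> \<circ> \<phi>)) x m = - x m"
      using last[of "\<phi> x"] x by (simp add: last tau_e \<beta>\<phi>)
    show "(\<beta> \<circ> (F \<circ> \<phi>)) ((\<beta> \<circ> (\<tau> \<circ> \<phi>)) x) = (\<beta> \<circ> (F \<circ> \<phi>)) x"
      using x by (simp add: \<phi>\<beta> \<tau>1 \<phi>1 F_tau)
    show "(\<beta> \<circ> (F \<circ> \<phi>)) x \<in> A" if "x m = 0"
    proof -
      have "\<phi> x \<bullet> e = 0" using last[of "\<phi> x"] x that by (simp add: \<beta>\<phi>)
      then have "F (\<phi> x) \<noteq> q" using q(2) \<phi>1 x by auto
      then have "\<beta> (F (\<phi> x)) \<noteq> \<beta> q" using \<phi>\<beta> F1 \<phi>1 x q(1) by metis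
      then show ?thesis using \<beta>1 F1 \<phi>1 x by (auto simp: A_def)
    qed
  next
    have "(subtopology (nsphere m) A) homeomorphic_space (top_of_set (sphere 0 1 - {q}))"
    proof -
      have "homeomorphic_maps (subtopology (nsphere m) A)
              (subtopology (top_of_set (sphere 0 1)) (sphere 0 1 - {q})) \<phi> \<beta>"
        by (rule homeomorphic_maps_subtopologies_alt[OF hm])
           (use \<beta>1 \<phi>1 \<beta>\<phi> \<phi>\<beta> q(1) in \<open>auto simp: A_def\<close>, metis \<phi>\<beta>)
      moreover have "sphere 0 1 \<inter> (sphere 0 1 - {q}) = sphere 0 1 - {q}" by auto
      ultimately show ?thesis
        by (auto simp: homeomorphic_space_def subtopology_subtopology)
    qed
    moreover have "contractible_space (top_of_set (sphere 0 1 - {q}))"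
    proof -
      have "q \<noteq> 0" using q(1) by auto
      then have "(sphere 0 1 - {q}) homeomorphic {x. q \<bullet> x = 0}"
        using q(1) by (intro homeomorphic_punctured_sphere_hyperplane) auto
      moreover have "contractible {x. q \<bullet> x = 0}"
        by (simp add: convex_imp_contractible convex_hyperplane)
      ultimately have "contractible (sphere 0 1 - {q})"
        using homeomorphic_contractible_eq by blast
      then show ?thesis by (simp add: contractible_space_def contractible_def)
    qed
    ultimately show "contractible_space (subtopology (nsphere m) A)"
      using homeomorphic_space_contractibility by blast
    have "q \<noteq> - q" using q(1) by (metis eq_neg_iff_add_eq_0 norm_zero scaleR_2 scale_eq_0_iff zero_neq_numeral zero_neq_one)
    then have "\<beta> (- q) \<noteq> \<beta> q" using \<phi>\<beta>[of q] \<phi>\<beta>[of "-q"] q(1) by (metis norm_minus_cancel)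
    then show "topspace (nsphere m) \<inter> A \<noteq> {}" using \<beta>1[of "-q"] q(1) by (auto simp: A_def)
  qed
  moreover have "Brouwer_degree2 m (\<beta> \<circ> (F \<circ> \<phi>)) = Brouwer_degree2 m id"
    by (rule Brouwer_degree2_homotopic[OF trans[OF hom]])
  ultimately show False by simp
qed

lemma homotopic_normalized_maps:
  fixes f h :: "'a::euclidean_space \<Rightarrow> 'b::euclidean_space"
  assumes "continuous_on S f" "continuous_on S h"
    and nz: "\<And>x s. x \<in> S \<Longrightarrow> 0 \<le> s \<Longrightarrow> s \<le> 1 \<Longrightarrow> (1 - s) *\<^sub>R f x + s *\<^sub>R h x \<noteq> 0"
  shows "homotopic_with_canon (\<lambda>_. True) S (sphere 0 1)
           (\<lambda>x. f x /\<^sub>R norm (f x)) (\<lambda>x. h x /\<^sub>R norm (h x))"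
proof -
  have "homotopic_with_canon (\<lambda>_. True) S (- {0}) f h"
    using assms by (intro homotopic_with_linear) (auto simp: closed_segment_def)
  then have "homotopic_with_canon (\<lambda>_. True) S (sphere 0 1)
      ((\<lambda>y. y /\<^sub>R norm y) \<circ> f) ((\<lambda>y. y /\<^sub>R norm y) \<circ> h)"
    by (rule homotopic_with_compose_continuous_left) (auto intro!: continuous_intros)
  then show ?thesis by (simp add: o_def)
qed

text \<open>
  If \<open>g x\<close> and \<open>g (\<tau> x)\<close> are never opposite, then \<open>h x = g x + g (\<tau> x)\<close> has no zeros and its
  normalisation is a \<open>\<tau>\<close>-invariant map homotopic to \<open>g\<close>. A polynomial approximation of \<open>h\<close>,
  symmetrised under \<open>\<tau>\<close>, makes it smooth, so that it does not map the equator orthogonal to \<open>e\<close> onto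
  the sphere; then it cannot be homotopic to the identity.
\<close>
lemma exists_opposite_values_on_involution_orbit:
  fixes g \<tau> :: "'a::euclidean_space \<Rightarrow> 'a"
  assumes \<tau>: "orthogonal_transformation \<tau>" "\<And>x. \<tau> (\<tau> x) = x"
    and e: "norm e = 1" "\<tau> e = - e"
    and tau_id: "homotopic_with_canon (\<lambda>_. True) (sphere 0 1) (sphere 0 1) \<tau> id"
    and g_id: "homotopic_with_canon (\<lambda>_. True) (sphere 0 1) (sphere 0 1) g id"
  obtains x where "norm x = 1" "g (\<tau> x) = - g x"
proof (rule ccontr)
  assume "\<not> thesis"
  then have no: "\<And>x. norm x = 1 \<Longrightarrow> g (\<tau> x) \<noteq> - g x"
    using that by blast
  have contg: "continuous_on (sphere 0 1) g"
    using homotopic_with_imp_continuous[OF g_id] by simp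
  have g1: "norm (g x) = 1" if "norm x = 1" for x
    using homotopic_with_imp_subset1[OF g_id] that by (auto simp: image_subset_iff)
  have lin\<tau>: "linear \<tau>" and \<tau>1: "norm (\<tau> x) = norm x" for x
    using \<tau>(1) by (auto simp: orthogonal_transformation)
  have diff\<tau>: "\<tau> differentiable_on X" and cont\<tau>: "continuous_on X \<tau>" for X
    using lin\<tau> by (auto simp: linear_imp_differentiable_on linear_continuous_on linear_conv_bounded_linear)
  have tau_e: "\<tau> x \<bullet> e = - (x \<bullet> e)" for x
    using \<tau> e(2) by (metis inner_minus_right orthogonal_transformation_def)
  define h where "h x = g x + g (\<tau> x)" for x
  have conth: "continuous_on (sphere 0 1) h"
    unfolding h_def using contg cont\<tau>
    by (intro continuous_on_add continuous_on_compose2[OF contg cont\<tau>]) (auto simp: \<tau>1)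
  have h_tau: "h (\<tau> x) = h x" for x by (simp add: h_def \<tau>(2) add.commute)
  have h0: "h x \<noteq> 0" if "norm x = 1" for x
    using no[OF that] by (simp add: h_def) (metis add.commute add_eq_0_iff)
  \<comment> \<open>A margin within which approximations of \<open>h\<close> keep away from 0.\<close>
  obtain \<delta> where \<delta>: "\<delta> > 0" "\<And>x. norm x = 1 \<Longrightarrow> norm (h x) \<ge> \<delta>"
  proof -
    have "\<exists>x\<in>sphere 0 1. \<forall>y\<in>sphere 0 1. norm (h x) \<le> norm (h y)"
      using e(1) by (intro continuous_attains_inf continuous_on_norm conth) auto
    then show thesis using that h0 by (metis mem_sphere_0 zero_less_norm_iff)
  qed
  obtain p where p: "polynomial_function p" "\<And>x. norm x = 1 \<Longrightarrow> norm (h x - p x) < \<delta>"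
    using Stone_Weierstrass_polynomial_function[OF compact_sphere conth \<delta>(1)] by auto
  define H where "H x = (1/2) *\<^sub>R (p x + p (\<tau> x))" for x
  have H_tau: "H (\<tau> x) = H x" for x by (simp add: H_def \<tau>(2) add.commute)
  have Hh: "norm (h x - H x) < \<delta>" if "norm x = 1" for x
  proof -
    have "h x - H x = (1/2) *\<^sub>R ((h x - p x) + (h (\<tau> x) - p (\<tau> x)))"
      by (simp add: H_def h_tau algebra_simps flip: scaleR_add_left)
    moreover have "norm ((h x - p x) + (h (\<tau> x) - p (\<tau> x))) < \<delta> + \<delta>"
      using p(2)[of x] p(2)[of "\<tau> x"] that
      by (intro le_less_trans[OF norm_triangle_ineq]) (simp add: \<tau>1)
    ultimately show ?thesis by simp
  qed
  have pd: "p differentiable_on X" for X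
    using p(1) by (simp add: differentiable_on_polynomial_function)
  have diffH: "H differentiable_on X" for X
    unfolding H_def using differentiable_on_compose[OF diff\<tau> pd] 
    by (intro derivative_intros pd differentiable_on_compose[OF diff\<tau> pd])
  have seg: "(1 - s) *\<^sub>R h x + s *\<^sub>R H x \<noteq> 0" if "norm x = 1" "0 \<le> s" "s \<le> 1" for x s
  proof
    assume "(1 - s) *\<^sub>R h x + s *\<^sub>R H x = 0"
    then have "h x = s *\<^sub>R (h x - H x)" by (simp add: algebra_simps)
    then have "norm (h x) = s * norm (h x - H x)" using that by (metis abs_of_nonneg norm_scaleR)
    also have "\<dots> \<le> norm (h x - H x)" using that by (simp add: mult_left_le_one_le)
    finally show False using Hh \<delta> that by fastforce
  qed
  have H0: "H x \<noteq> 0" if "norm x = 1" for x using seg[of x 1] that by simp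
  define F where "F x = H x /\<^sub>R norm (H x)" for x
  have F1: "norm (F x) = 1" if "norm x = 1" for x using H0 that by (simp add: F_def)
  have contF: "continuous_on (sphere 0 1) F"
    unfolding F_def using H0 differentiable_imp_continuous_on[OF diffH]
    by (intro continuous_intros) auto
  have "homotopic_with_canon (\<lambda>_. True) (sphere 0 1) (sphere 0 1)
      (\<lambda>x. g x /\<^sub>R norm (g x)) (\<lambda>x. h x /\<^sub>R norm (h x))"
  proof (rule homotopic_normalized_maps[OF contg conth])
    fix x :: 'a and s :: real assume x: "x \<in> sphere 0 1" and s: "0 \<le> s" "s \<le> 1"
    show "(1 - s) *\<^sub>R g x + s *\<^sub>R h x \<noteq> 0"
    proof
      assume "(1 - s) *\<^sub>R g x + s *\<^sub>R h x = 0"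
      then have eq: "g x = - (s *\<^sub>R g (\<tau> x))" by (simp add: h_def algebra_simps eq_neg_iff_add_eq_0)
      then have "norm (g x) = s * norm (g (\<tau> x))" using s by simp
      then have "s = 1" using x by (simp add: g1 \<tau>1)
      then show False using eq no[of x] x by simp
    qed
  qed
  moreover have "homotopic_with_canon (\<lambda>_. True) (sphere 0 1) (sphere 0 1)
      (\<lambda>x. h x /\<^sub>R norm (h x)) (\<lambda>x. H x /\<^sub>R norm (H x))"
    using seg differentiable_imp_continuous_on[OF diffH] conth
    by (intro homotopic_normalized_maps) auto
  ultimately have "homotopic_with_canon (\<lambda>_. True) (sphere 0 1) (sphere 0 1)
      (\<lambda>x. g x /\<^sub>R norm (g x)) F"
    unfolding F_def[abs_def] by (rule homotopic_with_trans)
  then have "homotopic_with_canon (\<lambda>_. True) (sphere 0 1) (sphere 0 1) g F"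
    by (rule homotopic_with_eq) (auto simp: g1)
  then have F_id: "homotopic_with_canon (\<lambda>_. True) (sphere 0 1) (sphere 0 1) F id"
    using g_id homotopic_with_symD homotopic_with_trans by blast
  \<comment> \<open>A smooth map does not raise dimension.\<close>
  have "F ` (sphere 0 1 \<inter> {x. e \<bullet> x = 0}) \<noteq> sphere 0 1 \<inter> UNIV"
  proof (rule spheremap_lemma1)
    show "dim {x. e \<bullet> x = 0} < dim (UNIV :: 'a set)"
      using dim_hyperplane[of e] e(1) DIM_positive[where 'a='a] by (cases "e = 0") auto
    show "F differentiable_on sphere 0 1 \<inter> {x. e \<bullet> x = 0}"
    proof -
      have "(\<lambda>x. norm (H x)) differentiable_on sphere 0 1 \<inter> {x. e \<bullet> x = 0}"
        by (rule differentiable_on_compose[OF diffH differentiable_on_norm]) (use H0 in force)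
      then show ?thesis
        unfolding F_def using H0 by (intro derivative_intros diffH) auto
    qed
  qed (auto simp: subspace_hyperplane)
  moreover have "F ` (sphere 0 1 \<inter> {x. e \<bullet> x = 0}) \<subseteq> sphere 0 1" using F1 by auto
  ultimately obtain q where q: "q \<in> sphere 0 1" "q \<notin> F ` (sphere 0 1 \<inter> {x. e \<bullet> x = 0})"
    by blast
  have "\<not> homotopic_with_canon (\<lambda>_. True) (sphere 0 1) (sphere 0 1) F id"
  proof (rule invariant_map_not_homotopic_to_id[OF contF _ tau_id e(1) tau_e])
    show "F ` sphere 0 1 \<subseteq> sphere 0 1" using F1 by auto
    show "F (\<tau> x) = F x" for x by (simp add: F_def H_tau)
    show "norm q = 1" using q(1) by simp
    show "F x \<noteq> q" if "norm x = 1" "x \<bullet> e = 0" for x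
    proof -
      have "x \<in> sphere 0 1 \<inter> {x. e \<bullet> x = 0}" using that by (simp add: inner_commute)
      then show ?thesis using q(2) by blast
    qed
  qed
  then show False using F_id by simp
qed

section \<open>Angles and the metric of a product of spheres\<close>

definition angle :: "'a::real_inner \<Rightarrow> 'a \<Rightarrow> real" where
  "angle x y = arccos (x \<bullet> y)"

lemma inner_unit_bounds:
  fixes x y :: "'a::real_inner"
  assumes "norm x = 1" "norm y = 1"
  shows "-1 \<le> x \<bullet> y" "x \<bullet> y \<le> 1"
  using Cauchy_Schwarz_ineq2[of x y] assms by auto

lemma angle_bounds:
  fixes x y :: "'a::real_inner"
  assumes "norm x = 1" "norm y = 1"
  shows "0 \<le> angle x y" "angle x y \<le> pi"
  using inner_unit_bounds[OF assms] by (auto simp: angle_def arccos_lbound arccos_ubound)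

lemma cos_angle:
  fixes x y :: "'a::real_inner"
  assumes "norm x = 1" "norm y = 1"
  shows "cos (angle x y) = x \<bullet> y"
  using inner_unit_bounds[OF assms] by (simp add: angle_def)

lemma angle_eqI:
  fixes x y :: "'a::real_inner"
  assumes "x \<bullet> y = cos t" "0 \<le> t" "t \<le> pi"
  shows "angle x y = t"
  using assms by (simp add: angle_def arccos_cos)

lemma angle_minus:
  fixes x y :: "'a::real_inner"
  assumes "norm x = 1" "norm y = 1"
  shows "angle (- x) y = pi - angle x y" "angle x (- y) = pi - angle x y"
  using inner_unit_bounds[OF assms] by (auto simp: angle_def arccos_minus)

lemma angle_orthogonal: "x \<bullet> y = 0 \<Longrightarrow> angle x y = pi / 2"
  by (simp add: angle_def)

lemma orthogonal_if_angle:
  fixes x y :: "'a::real_inner"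
  assumes "norm x = 1" "norm y = 1" "angle x y = pi / 2"
  shows "x \<bullet> y = 0"
  using cos_angle[OF assms(1,2)] assms(3) by simp

lemma eq_minus_if_angle_pi:
  fixes x y :: "'a::real_inner"
  assumes "norm x = 1" "norm y = 1" "angle x y \<ge> pi"
  shows "y = - x"
proof -
  have "angle x y = pi" using angle_bounds[OF assms(1,2)] assms(3) by simp
  then have "x \<bullet> y = -1" using cos_angle[OF assms(1,2)] by simp
  moreover have "x \<bullet> x = 1" "y \<bullet> y = 1" using assms(1,2) by (simp_all add: dot_square_norm)
  moreover have "(x + y) \<bullet> (x + y) = x \<bullet> x + 2 * (x \<bullet> y) + y \<bullet> y"
    by (simp only: inner_add_left inner_add_right inner_commute[of y x])
  ultimately have "(x + y) \<bullet> (x + y) = 0" by linarith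
  then have "x + y = 0" by (rule inner_eq_zero_iff[THEN iffD1])
  then show ?thesis by (simp add: eq_neg_iff_add_eq_0 add.commute)
qed

text \<open>
  Decompose \<open>x\<close> and \<open>z\<close> into their parts \<open>u\<close> and \<open>w\<close> orthogonal to \<open>y\<close>, of lengths \<open>sin a\<close> and
  \<open>sin b\<close>, and their parts along \<open>y\<close>. The Cauchy-Schwarz inequality for \<open>u\<close> and \<open>w\<close> is then
  \<open>cos (a + b) \<le> x \<bullet> z\<close>.
\<close>
lemma angle_triangle:
  fixes x y z :: "'a::real_inner"
  assumes "norm x = 1" "norm y = 1" "norm z = 1"
  shows "angle x z \<le> angle x y + angle y z"
proof (cases "angle x y + angle y z \<le> pi")
  case True
  define a where "a = angle x y"
  define b where "b = angle y z"
  have xy: "x \<bullet> y = cos a" and yz: "y \<bullet> z = cos b"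
    unfolding a_def b_def by (simp_all add: cos_angle assms)
  have ab: "0 \<le> a" "a \<le> pi" "0 \<le> b" "b \<le> pi"
    unfolding a_def b_def by (simp_all add: angle_bounds assms)
  define u where "u = x - cos a *\<^sub>R y"
  define w where "w = z - cos b *\<^sub>R y"
  have one: "x \<bullet> x = 1" "y \<bullet> y = 1" "z \<bullet> z = 1" using assms by (auto simp: dot_square_norm)
  have "u \<bullet> u = (sin a)\<^sup>2"
    using xy one by (simp add: u_def inner_diff_left inner_diff_right inner_commute sin_squared_eq) (simp add: power2_eq_square)
  then have nu: "norm u = sin a" using ab by (simp add: norm_eq_sqrt_inner sin_ge_zero)
  have "w \<bullet> w = (sin b)\<^sup>2"
    using yz one by (simp add: w_def inner_diff_left inner_diff_right inner_commute sin_squared_eq) (simp add: power2_eq_square)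
  then have nw: "norm w = sin b" using ab by (simp add: norm_eq_sqrt_inner sin_ge_zero)
  have "x \<bullet> z = cos a * cos b + u \<bullet> w"
    using xy yz one by (simp add: u_def w_def inner_diff_left inner_diff_right inner_commute)
  moreover have "- (sin a * sin b) \<le> u \<bullet> w"
    using Cauchy_Schwarz_ineq2[of u w] nu nw by simp
  ultimately have "cos (a + b) \<le> x \<bullet> z" by (simp add: cos_add)
  then have "arccos (x \<bullet> z) \<le> arccos (cos (a + b))"
    using inner_unit_bounds[of x z] assms by (intro arccos_le_mono[THEN iffD2]) auto
  also have "\<dots> = a + b" using True ab by (intro arccos_cos) (auto simp: a_def b_def)
  finally show ?thesis by (simp add: angle_def[of x z] a_def b_def)
next
  case False
  then show ?thesis using angle_bounds[of x z] assms by simp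
qed

lemma unit_vector_orthogonal_to:
  fixes T :: "'a::euclidean_space set"
  assumes "dim T < DIM('a)"
  obtains w where "norm w = 1" "\<And>u. u \<in> T \<Longrightarrow> u \<bullet> w = 0"
proof -
  obtain v where v: "v \<noteq> 0" "\<And>u. u \<in> span T \<Longrightarrow> orthogonal v u"
    using orthogonal_to_subspace_exists[OF assms] by metis
  show thesis
    by (rule that[of "v /\<^sub>R norm v"])
       (use v span_base in \<open>auto simp: orthogonal_def inner_commute\<close>)
qed

lemma circle_norm:
  fixes x w :: "'a::real_inner"
  assumes "norm x = 1" "norm w = 1" "x \<bullet> w = 0"
  shows "norm (cos t *\<^sub>R x + sin t *\<^sub>R w) = 1"
proof -
  have "x \<bullet> x = 1" "w \<bullet> w = 1" "w \<bullet> x = 0"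
    using assms by (simp_all add: dot_square_norm inner_commute)
  then have "(cos t *\<^sub>R x + sin t *\<^sub>R w) \<bullet> (cos t *\<^sub>R x + sin t *\<^sub>R w) = (cos t)\<^sup>2 + (sin t)\<^sup>2"
    using assms(3) by (simp add: inner_add_left inner_add_right power2_eq_square)
  then show ?thesis by (simp add: norm_eq_1)
qed

text \<open>
  The chord of an arc of length \<open>2 t\<close> is \<open>2 sin t\<close>, and \<open>arcsin\<close> has derivative 1 at 0.
\<close>
lemma angle_le_chord:
  assumes "0 < (\<eta>::real)"
  obtains \<delta> where "\<delta> > 0"
    "\<And>x y :: 'a::real_inner. norm x = 1 \<Longrightarrow> norm y = 1 \<Longrightarrow> norm (x - y) < \<delta> \<Longrightarrow>
        angle x y \<le> (1 + \<eta>) * norm (x - y)"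
proof -
  have "(arcsin has_real_derivative 1) (at 0)"
    using DERIV_arcsin[of 0] by simp
  then have "((\<lambda>h. arcsin h / h) \<longlongrightarrow> 1) (at 0)"
    by (simp add: DERIV_def)
  then have "\<forall>\<^sub>F h in at 0. arcsin h / h < 1 + \<eta>"
    using assms by (intro order_tendstoD) auto
  then obtain d where d: "d > 0" "\<And>h. h \<noteq> 0 \<Longrightarrow> \<bar>h\<bar> < d \<Longrightarrow> arcsin h / h < 1 + \<eta>"
    by (auto simp: eventually_at)
  show thesis
  proof
    show "2 * d > 0" using d by simp
    fix x y :: 'a assume xy: "norm x = 1" "norm y = 1" "norm (x - y) < 2 * d"
    define t where "t = angle x y / 2"
    have t: "0 \<le> t" "t \<le> pi / 2" using angle_bounds[OF xy(1,2)] by (auto simp: t_def)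
    have "(norm (x - y))\<^sup>2 = 2 - 2 * (x \<bullet> y)"
    proof -
      have "x \<bullet> x = 1" "y \<bullet> y = 1" using xy by (simp_all add: dot_square_norm)
      then show ?thesis
        by (simp add: power2_norm_eq_inner inner_diff_left inner_diff_right inner_commute)
    qed
    also have "x \<bullet> y = cos (2 * t)" using cos_angle[OF xy(1,2)] by (simp add: t_def)
    also have "2 - 2 * cos (2 * t) = (2 * sin t)\<^sup>2" by (simp add: cos_double_sin power2_eq_square)
    finally have n: "norm (x - y) = 2 * sin t"
      by (rule power2_eq_imp_eq) (use t sin_ge_zero[of t] in auto)
    have "t = arcsin (sin t)" using t by (simp add: arcsin_sin)
    also have "\<dots> \<le> (1 + \<eta>) * sin t"
    proof (cases "sin t = 0")
      case False
      then have "sin t > 0" using t sin_ge_zero[of t] by simp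
      then show ?thesis using d(2)[of "sin t"] xy(3) n by (simp add: divide_less_eq)
    qed simp
    finally show "angle x y \<le> (1 + \<eta>) * norm (x - y)" by (simp add: n t_def)
  qed
qed

text \<open>
  The geodesic distance of the product of two unit spheres.
\<close>
definition product_angle :: "'a::real_inner \<times> 'a \<Rightarrow> 'a \<times> 'a \<Rightarrow> real" where
  "product_angle P Q = sqrt ((angle (fst P) (fst Q))\<^sup>2 + (angle (snd P) (snd Q))\<^sup>2)"

abbreviation sphere_product :: "('a::real_inner \<times> 'a) set" where
  "sphere_product \<equiv> sphere 0 1 \<times> sphere 0 1"

lemma product_angle_triangle:
  assumes "P \<in> sphere_product" "Q \<in> sphere_product" "R \<in> sphere_product"
  shows "product_angle P R \<le> product_angle P Q + product_angle Q R"
proof -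
  have 1: "angle (fst P) (fst R) \<le> angle (fst P) (fst Q) + angle (fst Q) (fst R)"
    and 2: "angle (snd P) (snd R) \<le> angle (snd P) (snd Q) + angle (snd Q) (snd R)"
    using assms by (auto intro!: angle_triangle simp: mem_Times_iff)
  have "product_angle P R \<le> sqrt ((angle (fst P) (fst Q) + angle (fst Q) (fst R))\<^sup>2
      + (angle (snd P) (snd Q) + angle (snd Q) (snd R))\<^sup>2)"
    unfolding product_angle_def using 1 2 assms angle_bounds
    by (intro real_sqrt_le_mono add_mono power_mono) (auto simp: mem_Times_iff)
  also have "\<dots> \<le> product_angle P Q + product_angle Q R"
    unfolding product_angle_def by (rule real_sqrt_sum_squares_triangle_ineq)
  finally show ?thesis .
qed

lemma product_angle_le_chord:
  assumes "0 < (\<eta>::real)"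
  obtains \<delta> where "\<delta> > 0"
    "\<And>P Q :: 'a::real_inner \<times> 'a. P \<in> sphere_product \<Longrightarrow> Q \<in> sphere_product \<Longrightarrow>
       norm (P - Q) < \<delta> \<Longrightarrow> product_angle P Q \<le> (1 + \<eta>) * norm (P - Q)"
proof -
  obtain \<delta> where \<delta>: "\<delta> > 0"
    "\<And>x y :: 'a. norm x = 1 \<Longrightarrow> norm y = 1 \<Longrightarrow> norm (x - y) < \<delta> \<Longrightarrow>
        angle x y \<le> (1 + \<eta>) * norm (x - y)"
    using angle_le_chord[OF assms] by metis
  show thesis
  proof
    show "\<delta> > 0" by fact
    fix P Q :: "'a \<times> 'a" assume PQ: "P \<in> sphere_product" "Q \<in> sphere_product" "norm (P - Q) < \<delta>"
    have "norm (fst (P - Q)) \<le> norm (P - Q)" "norm (snd (P - Q)) \<le> norm (P - Q)"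
      by (metis norm_fst_le prod.collapse, metis norm_snd_le prod.collapse)
    then have "norm (fst P - fst Q) < \<delta>" "norm (snd P - snd Q) < \<delta>"
      using PQ(3) by auto
    then have 1: "angle (fst P) (fst Q) \<le> (1 + \<eta>) * norm (fst P - fst Q)"
      and 2: "angle (snd P) (snd Q) \<le> (1 + \<eta>) * norm (snd P - snd Q)"
      using PQ by (auto intro!: \<delta>(2) simp: mem_Times_iff)
    have "product_angle P Q \<le> sqrt (((1 + \<eta>) * norm (fst P - fst Q))\<^sup>2 + ((1 + \<eta>) * norm (snd P - snd Q))\<^sup>2)"
      unfolding product_angle_def using 1 2 PQ angle_bounds
      by (intro real_sqrt_le_mono add_mono power_mono) (auto simp: mem_Times_iff)
    also have "\<dots> = sqrt ((1 + \<eta>)\<^sup>2 * ((norm (fst P - fst Q))\<^sup>2 + (norm (snd P - snd Q))\<^sup>2))"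
      by (simp add: power_mult_distrib distrib_left)
    also have "\<dots> = (1 + \<eta>) * norm (P - Q)"
      using assms by (simp add: real_sqrt_mult norm_prod_def)
    finally show "product_angle P Q \<le> (1 + \<eta>) * norm (P - Q)" .
  qed
qed

section \<open>Lengths of curves and geodesic distance\<close>

text \<open>
  The fundamental theorem of calculus, with finitely many exceptional points.
\<close>
lemma chord_le_length:
  fixes \<gamma> :: "real \<Rightarrow> 'a::euclidean_space"
  assumes \<gamma>: "valid_path \<gamma>"
    and int: "(\<lambda>t. norm (vector_derivative \<gamma> (at t))) integrable_on {0..1}"
    and st: "0 \<le> s" "s \<le> t" "t \<le> 1"
  shows "norm (\<gamma> t - \<gamma> s) \<le> integral {s..t} (\<lambda>t. norm (vector_derivative \<gamma> (at t)))"
proof -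
  obtain K where K: "finite K" "\<gamma> C1_differentiable_on {0..1} - K" and cont: "continuous_on {0..1} \<gamma>"
    using \<gamma> by (auto simp: valid_path_def piecewise_C1_differentiable_on_def)
  have der: "(\<gamma> has_vector_derivative vector_derivative \<gamma> (at x)) (at x)" if "x \<in> {0..1} - K" for x
    using K(2) that by (auto simp: C1_differentiable_on_eq vector_derivative_works)
  have "((\<lambda>x. vector_derivative \<gamma> (at x)) has_integral (\<gamma> t - \<gamma> s)) {s..t}"
  proof (rule fundamental_theorem_of_calculus_interior_strong[OF K(1) st(2)])
    show "(\<gamma> has_vector_derivative vector_derivative \<gamma> (at x)) (at x)" if "x \<in> {s<..<t} - K" for x
      using that st by (intro der) auto
    show "continuous_on {s..t} \<gamma>" by (rule continuous_on_subset[OF cont]) (use st in auto)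
  qed
  moreover have "(\<lambda>t. norm (vector_derivative \<gamma> (at t))) integrable_on {s..t}"
    by (rule integrable_on_subinterval[OF int]) (use st in auto)
  ultimately show ?thesis
    by (metis (no_types, lifting) integral_norm_bound_integral has_integral_iff order_refl)
qed

text \<open>
  On a fine subdivision of the curve chords and angles agree up to a factor \<open>1 + \<eta>\<close>. The chords add up to
  at most the length, the angles to at least the distance of the end points by the triangle inequality.
\<close>
lemma product_angle_le_length:
  fixes \<gamma> :: "real \<Rightarrow> 'a::euclidean_space \<times> 'a"
  assumes \<gamma>: "valid_path \<gamma>" "path_image \<gamma> \<subseteq> sphere_product"
    and L: "((\<lambda>t. norm (vector_derivative \<gamma> (at t))) has_integral L) {0..1}"
  shows "product_angle (pathstart \<gamma>) (pathfinish \<gamma>) \<le> L"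
proof -
  define I where "I s t = integral {s..t} (\<lambda>t. norm (vector_derivative \<gamma> (at t)))" for s t
  have int: "(\<lambda>t. norm (vector_derivative \<gamma> (at t))) integrable_on {0..1}"
    and IL: "I 0 1 = L"
    using L by (auto simp: I_def has_integral_iff)
  have S: "\<gamma> t \<in> sphere_product" if "0 \<le> t" "t \<le> 1" for t
    using \<gamma>(2) that by (auto simp: path_image_def)
  have main: "product_angle (\<gamma> 0) (\<gamma> 1) \<le> (1 + \<eta>) * L" if \<eta>: "\<eta> > 0" for \<eta>
  proof -
    obtain \<delta> where \<delta>: "\<delta> > 0"
      "\<And>P Q :: 'a \<times> 'a. P \<in> sphere_product \<Longrightarrow> Q \<in> sphere_product \<Longrightarrow>
         norm (P - Q) < \<delta> \<Longrightarrow> product_angle P Q \<le> (1 + \<eta>) * norm (P - Q)"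
      using product_angle_le_chord[OF \<eta>] by metis
    have "uniformly_continuous_on {0..1} \<gamma>"
      using \<gamma>(1) by (intro compact_uniformly_continuous) (auto simp: valid_path_def piecewise_C1_differentiable_on_def)
    then obtain d where d: "d > 0" "\<And>s t. s \<in> {0..1} \<Longrightarrow> t \<in> {0..1} \<Longrightarrow> \<bar>t - s\<bar> < d \<Longrightarrow> norm (\<gamma> t - \<gamma> s) < \<delta>"
      using \<delta>(1) unfolding uniformly_continuous_on_def dist_norm real_norm_def by metis
    obtain N :: nat where N: "N > 0" "1 / N < d"
      using d(1) by (metis inverse_eq_divide real_arch_inverse of_nat_0_less_iff zero_less_iff_neq_zero)
    \<comment> \<open>Walk along the curve in \<open>N\<close> steps, each with a chord shorter than \<open>\<delta>\<close>.\<close>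
    have "product_angle (\<gamma> 0) (\<gamma> (k / N)) \<le> (1 + \<eta>) * I 0 (k / N)" if "k \<le> N" for k :: nat
      using that
    proof (induction k)
      case 0
      have "product_angle (\<gamma> 0) (\<gamma> 0) = 0"
        using S[of 0] by (auto simp: product_angle_def angle_def mem_Times_iff dot_square_norm)
      then show ?case by (simp add: I_def)
    next
      case (Suc k)
      define s where "s = k / N"
      define t where "t = Suc k / N"
      have st: "0 \<le> s" "s \<le> t" "t \<le> 1" "t - s = 1 / N"
        using Suc.prems N by (auto simp: s_def t_def divide_simps)
      have "norm (\<gamma> t - \<gamma> s) < \<delta>" using st N by (intro d(2)) auto
      then have "product_angle (\<gamma> s) (\<gamma> t) \<le> (1 + \<eta>) * norm (\<gamma> t - \<gamma> s)"
        using \<delta>(2)[of "\<gamma> s" "\<gamma> t"] S st by (simp add: norm_minus_commute)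
      also have "\<dots> \<le> (1 + \<eta>) * I s t"
        using chord_le_length[OF \<gamma>(1) int st(1-3)] \<eta> by (auto simp: I_def)
      finally have "product_angle (\<gamma> 0) (\<gamma> t) \<le> (1 + \<eta>) * I 0 s + (1 + \<eta>) * I s t"
        using product_angle_triangle[of "\<gamma> 0" "\<gamma> s" "\<gamma> t"] S st Suc by (simp add: s_def)
      also have "\<dots> = (1 + \<eta>) * (I 0 s + I s t)" by (simp add: distrib_left)
      also have "I 0 s + I s t = I 0 t"
        unfolding I_def using st integrable_on_subinterval[OF int, of 0 t]
        by (intro Henstock_Kurzweil_Integration.integral_combine) auto
      finally show ?case by (simp add: t_def)
    qed
    from this[of N] show ?thesis using N IL by simp
  qed
  have "product_angle (\<gamma> 0) (\<gamma> 1) \<le> L"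
  proof (rule field_le_epsilon)
    fix e :: real assume e: "e > 0"
    have L0: "0 \<le> L" using has_integral_nonneg[OF L] by simp
    have "product_angle (\<gamma> 0) (\<gamma> 1) \<le> (1 + e / (L + 1)) * L"
      using e L0 by (intro main) auto
    also have "\<dots> = L + e * (L / (L + 1))" by (simp add: algebra_simps)
    also have "\<dots> \<le> L + e * 1" using e L0 by (intro add_left_mono mult_left_mono) auto
    finally show "product_angle (\<gamma> 0) (\<gamma> 1) \<le> L + e" by simp
  qed
  then show ?thesis by (simp add: pathstart_def pathfinish_def)
qed

definition curve_lengths :: "'a::euclidean_space set \<Rightarrow> 'a \<Rightarrow> 'a \<Rightarrow> real set" where
  "curve_lengths S x y = {L. \<exists>\<gamma>. valid_path \<gamma> \<and> path_image \<gamma> \<subseteq> S \<and> pathstart \<gamma> = x \<and> pathfinish \<gamma> = y \<and>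
              ((\<lambda>t. norm (vector_derivative \<gamma> (at t))) has_integral L) {0..1}}"

lemma geodesic_dist_eq: "geodesic_dist S x y = Inf (curve_lengths S x y)"
  by (simp add: geodesic_dist_def curve_lengths_def)

lemma curve_lengths_nonneg: "L \<in> curve_lengths S x y \<Longrightarrow> 0 \<le> L"
  by (auto simp: curve_lengths_def intro: has_integral_nonneg)

lemma bdd_below_curve_lengths [simp]: "bdd_below (curve_lengths S x y)"
  by (rule bdd_belowI[of _ 0]) (rule curve_lengths_nonneg)

lemma geodesic_dist_le: "L \<in> curve_lengths S x y \<Longrightarrow> geodesic_dist S x y \<le> L"
  by (simp add: geodesic_dist_eq cInf_lower)

lemma geodesic_dist_nonneg: "curve_lengths S x y \<noteq> {} \<Longrightarrow> 0 \<le> geodesic_dist S x y"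
  unfolding geodesic_dist_eq by (rule cInf_greatest) (auto intro: curve_lengths_nonneg)

lemma geodesic_dist_antimono:
  assumes "S \<subseteq> T" "curve_lengths S x y \<noteq> {}"
  shows "geodesic_dist T x y \<le> geodesic_dist S x y"
  unfolding geodesic_dist_eq
  by (rule cInf_superset_mono[OF assms(2) bdd_below_curve_lengths])
     (use assms(1) in \<open>auto simp: curve_lengths_def\<close>)

lemma product_angle_le_geodesic_dist:
  assumes "curve_lengths S P Q \<noteq> {}" "S \<subseteq> sphere_product"
  shows "product_angle P Q \<le> geodesic_dist S P Q"
  unfolding geodesic_dist_eq
proof (rule cInf_greatest[OF assms(1)])
  fix L assume "L \<in> curve_lengths S P Q"
  then show "product_angle P Q \<le> L"
    using product_angle_le_length assms(2) unfolding curve_lengths_def by blast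
qed

text \<open>
  A linear isometry preserves the norm of the velocity.
\<close>
lemma curve_lengths_isometric_image:
  fixes A :: "'a::euclidean_space \<Rightarrow> 'b::euclidean_space"
  assumes A: "linear A" "\<And>x. norm (A x) = norm x" and im: "A ` S \<subseteq> T"
  shows "curve_lengths S x y \<subseteq> curve_lengths T (A x) (A y)"
proof
  fix L assume "L \<in> curve_lengths S x y"
  then obtain \<gamma> where \<gamma>: "valid_path \<gamma>" "path_image \<gamma> \<subseteq> S" "pathstart \<gamma> = x" "pathfinish \<gamma> = y"
    and L: "((\<lambda>t. norm (vector_derivative \<gamma> (at t))) has_integral L) {0..1}"
    by (auto simp: curve_lengths_def)
  have bl: "bounded_linear A" using A(1) by (simp add: linear_conv_bounded_linear)
  obtain K where K: "finite K" "\<gamma> C1_differentiable_on {0..1} - K"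
    using \<gamma>(1) by (auto simp: valid_path_def piecewise_C1_differentiable_on_def)
  have eq: "norm (vector_derivative (A \<circ> \<gamma>) (at t)) = norm (vector_derivative \<gamma> (at t))"
    if "t \<in> {0..1} - K" for t
  proof -
    have "(\<gamma> has_vector_derivative vector_derivative \<gamma> (at t)) (at t)"
      using K(2) that by (auto simp: C1_differentiable_on_eq vector_derivative_works)
    then have "((\<lambda>t. A (\<gamma> t)) has_vector_derivative A (vector_derivative \<gamma> (at t))) (at t)"
      by (rule bounded_linear.has_vector_derivative[OF bl])
    then show ?thesis by (simp add: vector_derivative_at o_def A(2))
  qed
  have "((\<lambda>t. norm (vector_derivative (A \<circ> \<gamma>) (at t))) has_integral L) {0..1}"
    by (rule has_integral_spike_finite[OF K(1) _ L]) (use eq in auto)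
  moreover have "valid_path (A \<circ> \<gamma>)"
    by (rule linear_image_valid_path) (use A \<gamma> in auto)
  moreover have "path_image (A \<circ> \<gamma>) \<subseteq> T" using \<gamma>(2) im by (auto simp: path_image_def)
  ultimately show "L \<in> curve_lengths T (A x) (A y)"
    using \<gamma>(3,4) by (auto simp: curve_lengths_def pathstart_def pathfinish_def intro!: exI[of _ "A \<circ> \<gamma>"])
qed

lemma geodesic_dist_isometric_image:
  fixes A B :: "'a::euclidean_space \<Rightarrow> 'a"
  assumes "linear A" "\<And>x. norm (A x) = norm x" "A ` S \<subseteq> S"
    and "linear B" "\<And>x. norm (B x) = norm x" "B ` S \<subseteq> S"
    and "\<And>x. B (A x) = x"
  shows "geodesic_dist S (A x) (A y) = geodesic_dist S x y"
proof -
  have "curve_lengths S x y \<subseteq> curve_lengths S (A x) (A y)"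
    by (intro curve_lengths_isometric_image) (use assms in auto)
  moreover have "curve_lengths S (A x) (A y) \<subseteq> curve_lengths S (B (A x)) (B (A y))"
    by (intro curve_lengths_isometric_image) (use assms in auto)
  ultimately show ?thesis using assms(7) by (simp add: geodesic_dist_eq)
qed

text \<open>
  Each half of the joined curve is traversed at twice the speed in half the time.
\<close>
lemma curve_lengths_join:
  assumes "K \<in> curve_lengths S x y" "L \<in> curve_lengths S y z"
  shows "K + L \<in> curve_lengths S x z"
proof -
  obtain g1 where g1: "valid_path g1" "path_image g1 \<subseteq> S" "pathstart g1 = x" "pathfinish g1 = y"
    and 1: "((\<lambda>t. norm (vector_derivative g1 (at t))) has_integral K) {0..1}"
    using assms(1) by (auto simp: curve_lengths_def)
  obtain g2 where g2: "valid_path g2" "path_image g2 \<subseteq> S" "pathstart g2 = y" "pathfinish g2 = z"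
    and 2: "((\<lambda>t. norm (vector_derivative g2 (at t))) has_integral L) {0..1}"
    using assms(2) by (auto simp: curve_lengths_def)
  obtain s1 s2
    where s1: "finite s1" "\<forall>x\<in>{0..1} - s1. g1 differentiable at x"
      and s2: "finite s2" "\<forall>x\<in>{0..1} - s2. g2 differentiable at x"
    using g1(1) g2(1)
    by (auto simp: valid_path_def piecewise_C1_differentiable_on_def C1_differentiable_on_eq)
  have i1: "((\<lambda>t. 2 * norm (vector_derivative g1 (at (2 * t)))) has_integral K) {0..1/2}"
    and i2: "((\<lambda>t. 2 * norm (vector_derivative g2 (at (2 * t - 1)))) has_integral L) {1/2..1}"
    using has_integral_affinity01 [OF 1, where m= 2 and c=0, THEN has_integral_cmul [where c=2]]
          has_integral_affinity01 [OF 2, where m= 2 and c="-1", THEN has_integral_cmul [where c=2]]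
    by (simp_all only: image_affinity_atLeastAtMost_div_diff, simp_all)
  have d1: "vector_derivative (g1 +++ g2) (at t) = 2 *\<^sub>R vector_derivative g1 (at (2 * t))"
    if "0 \<le> t" "2 * t < 1" "2 * t \<notin> s1" for t
  proof (rule vector_derivative_at [OF has_vector_derivative_transform_within])
    show "0 < \<bar>t - 1/2\<bar>" using that by auto
    have "((*) 2 has_vector_derivative 2) (at t)"
      by (simp add: has_vector_derivative_def has_derivative_def bounded_linear_mult_left)
    moreover have "(g1 has_vector_derivative vector_derivative g1 (at (2 * t))) (at (2 * t))"
      using s1 that by (auto simp: vector_derivative_works)
    ultimately show "((\<lambda>t. g1 (2 * t)) has_vector_derivative 2 *\<^sub>R vector_derivative g1 (at (2 * t))) (at t)"
      by (intro vector_diff_chain_at [simplified o_def])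
  qed (use that in \<open>simp_all add: joinpaths_def dist_real_def abs_if split: if_split_asm\<close>)
  have d2: "vector_derivative (g1 +++ g2) (at t) = 2 *\<^sub>R vector_derivative g2 (at (2 * t - 1))"
    if "1 < 2 * t" "t \<le> 1" "2 * t - 1 \<notin> s2" for t
  proof (rule vector_derivative_at [OF has_vector_derivative_transform_within])
    show "0 < \<bar>t - 1/2\<bar>" using that by auto
    have "((\<lambda>t. 2 * t - 1) has_vector_derivative 2) (at t)"
      by (simp add: has_vector_derivative_def has_derivative_def bounded_linear_mult_left)
    moreover have "(g2 has_vector_derivative vector_derivative g2 (at (2 * t - 1))) (at (2 * t - 1))"
      using s2 that by (auto simp: vector_derivative_works)
    ultimately show "((\<lambda>t. g2 (2 * t - 1)) has_vector_derivative 2 *\<^sub>R vector_derivative g2 (at (2 * t - 1))) (at t)"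
      by (intro vector_diff_chain_at [simplified o_def])
  qed (use that in \<open>simp_all add: joinpaths_def dist_real_def abs_if split: if_split_asm\<close>)
  have "((\<lambda>t. norm (vector_derivative (g1 +++ g2) (at t))) has_integral K) {0..1/2}"
  proof (rule has_integral_spike_finite [OF _ _ i1])
    show "finite (insert (1/2) ((*) 2 -` s1))"
      using s1 by (force intro: finite_vimageI [where h = "(*)2"] inj_onI)
  qed (auto simp: d1)
  moreover have "((\<lambda>t. norm (vector_derivative (g1 +++ g2) (at t))) has_integral L) {1/2..1}"
  proof (rule has_integral_spike_finite [OF _ _ i2])
    show "finite (insert (1/2) ((\<lambda>x. 2 * x - 1) -` s2))"
      using s2 by (force intro: finite_vimageI [where h = "\<lambda>x. 2*x-1"] inj_onI)
  qed (auto simp: d2)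
  ultimately have "((\<lambda>t. norm (vector_derivative (g1 +++ g2) (at t))) has_integral K + L) {0..1}"
    by (intro has_integral_combine [where c = "1/2"]) auto
  moreover have "valid_path (g1 +++ g2)" using g1 g2 by (intro valid_path_join) auto
  moreover have "path_image (g1 +++ g2) \<subseteq> S" using g1 g2 by (simp add: path_image_join)
  ultimately show ?thesis
    using g1 g2 unfolding curve_lengths_def by (auto intro!: exI[of _ "g1 +++ g2"])
qed

text \<open>
  A great circle through two points orthogonal to \<open>T\<close> can be chosen orthogonal to \<open>T\<close>. If the points are
  not equal or opposite, it is the one that they span. Otherwise \<open>sin (angle x y) = 0\<close> and any direction \<open>w\<close>
  will do, which exists because \<open>x\<close> and \<open>T\<close> do not span the space.
\<close>
lemma great_circle_through:
  fixes x y :: "'a::euclidean_space"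
  assumes dim: "dim (insert x T) < DIM('a)" and x: "norm x = 1" and y: "norm y = 1"
    and T: "\<And>u. u \<in> T \<Longrightarrow> u \<bullet> x = 0" "\<And>u. u \<in> T \<Longrightarrow> u \<bullet> y = 0"
  obtains w where "norm w = 1" "x \<bullet> w = 0" "\<And>u. u \<in> T \<Longrightarrow> u \<bullet> w = 0"
    "y = cos (angle x y) *\<^sub>R x + sin (angle x y) *\<^sub>R w"
proof -
  define t where "t = angle x y"
  have c: "x \<bullet> y = cos t" using cos_angle[OF x y] by (simp add: t_def)
  have s0: "sin t \<ge> 0" using angle_bounds[OF x y] by (simp add: t_def sin_ge_zero)
  define u where "u = y - cos t *\<^sub>R x"
  have one: "x \<bullet> x = 1" "y \<bullet> y = 1" using x y by (auto simp: dot_square_norm)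
  have xu: "x \<bullet> u = 0" using c one by (simp add: u_def inner_diff_right)
  have "u \<bullet> u = (sin t)\<^sup>2"
    using c one by (simp add: u_def inner_diff_left inner_diff_right inner_commute sin_squared_eq) (simp add: power2_eq_square)
  then have nu: "norm u = sin t" using s0 by (simp add: norm_eq_sqrt_inner)
  show thesis
  proof (cases "sin t = 0")
    case True
    then have "y = cos t *\<^sub>R x" using nu by (simp add: u_def)
    moreover obtain w where "norm w = 1" "\<And>u. u \<in> insert x T \<Longrightarrow> u \<bullet> w = 0"
      using unit_vector_orthogonal_to[OF dim] by metis
    ultimately show thesis using True by (intro that[of w]) (auto simp: t_def)
  next
    case False
    show thesis
    proof (rule that[of "u /\<^sub>R sin t"])
      show "norm (u /\<^sub>R sin t) = 1" using False nu s0 by simp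
      show "x \<bullet> (u /\<^sub>R sin t) = 0" using xu by simp
      show "v \<bullet> (u /\<^sub>R sin t) = 0" if "v \<in> T" for v
        using T[OF that] by (simp add: u_def inner_diff_right)
      show "y = cos (angle x y) *\<^sub>R x + sin (angle x y) *\<^sub>R (u /\<^sub>R sin t)"
        using False by (simp add: u_def flip: t_def)
    qed
  qed
qed

text \<open>
  The translation \<open>b\<close> allows \<open>V\<close> to move one component of a pair while the other one stays fixed.
\<close>
lemma circle_arc_curve_length:
  fixes V :: "'a::euclidean_space \<Rightarrow> 'b::euclidean_space"
  assumes xw: "norm x = 1" "norm w = 1" "x \<bullet> w = 0"
    and V: "linear V" "\<And>x. norm (V x) = k * norm x" and \<theta>: "0 \<le> \<theta>"
    and im: "\<And>t. V (cos t *\<^sub>R x + sin t *\<^sub>R w) + b \<in> S"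
  shows "k * \<theta> \<in> curve_lengths S (V x + b) (V (cos \<theta> *\<^sub>R x + sin \<theta> *\<^sub>R w) + b)"
proof -
  have blV: "bounded_linear V" using V(1) by (simp add: linear_conv_bounded_linear)
  have circ2: "norm (- sin t *\<^sub>R x + cos t *\<^sub>R w) = 1" for t
    using circle_norm[OF xw, of "t + pi / 2"] by (simp add: cos_add sin_add)
  define c where "c s = cos (\<theta> * s) *\<^sub>R x + sin (\<theta> * s) *\<^sub>R w" for s
  define \<gamma> where "\<gamma> s = V (c s) + b" for s
  define c' where "c' s = \<theta> *\<^sub>R (- sin (\<theta> * s) *\<^sub>R x + cos (\<theta> * s) *\<^sub>R w)" for s
  have "(c has_vector_derivative c' s) (at s)" for s
    unfolding c_def c'_def
    by (auto intro!: derivative_eq_intros simp: has_vector_derivative_def algebra_simps)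
  then have der: "(\<gamma> has_vector_derivative V (c' s)) (at s)" for s
    unfolding \<gamma>_def by (auto intro!: derivative_eq_intros bounded_linear.has_vector_derivative[OF blV])
  have speed: "norm (vector_derivative \<gamma> (at s)) = k * \<theta>" for s
    using vector_derivative_at[OF der] \<theta> circ2 by (simp add: V c'_def)
  have "continuous_on A c'" for A unfolding c'_def by (intro continuous_intros)
  then have "continuous_on A (\<lambda>s. V (c' s))" for A
    by (intro bounded_linear.continuous_on[OF blV])
  then have "\<gamma> C1_differentiable_on {0..1}"
    unfolding C1_differentiable_on_def
    by (intro exI[of _ "\<lambda>s. V (c' s)"]) (simp add: der)
  then have "valid_path \<gamma>" by (simp add: valid_path_def C1_differentiable_imp_piecewise)
  moreover have "path_image \<gamma> \<subseteq> S"
    using im by (auto simp: path_image_def \<gamma>_def c_def)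
  moreover have "pathstart \<gamma> = V x + b" "pathfinish \<gamma> = V (cos \<theta> *\<^sub>R x + sin \<theta> *\<^sub>R w) + b"
    by (simp_all add: pathstart_def pathfinish_def \<gamma>_def c_def)
  moreover have "((\<lambda>t. norm (vector_derivative \<gamma> (at t))) has_integral k * \<theta>) {0..1}"
    unfolding speed using has_integral_const_real[of "k * \<theta>" 0 1] by simp
  ultimately show ?thesis unfolding curve_lengths_def by blast
qed

text \<open>
  The map \<open>x \<mapsto> (x, J x)\<close> multiplies lengths by \<open>\<surd>2\<close>, so the great circles give curves in its image.
\<close>
lemma graph_curve_length:
  fixes J :: "'a::euclidean_space \<Rightarrow> 'a"
  assumes dim: "DIM('a) \<ge> 2" and J: "linear J" "\<And>x. norm (J x) = norm x"
    and xy: "norm x = 1" "norm y = 1"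
  shows "sqrt 2 * angle x y \<in> curve_lengths ((\<lambda>x. (x, J x)) ` sphere 0 1) (x, J x) (y, J y)"
proof -
  have "dim (insert x {}) < DIM('a)" using dim by (simp add: dim_insert)
  then obtain w where w: "norm w = 1" "x \<bullet> w = 0"
    and y: "y = cos (angle x y) *\<^sub>R x + sin (angle x y) *\<^sub>R w"
    using great_circle_through[OF _ xy] by blast
  define V where "V x = (x, J x)" for x
  have "linear V" unfolding V_def using J(1) by (intro linearI) (auto simp: linear_add linear_scale)
  moreover have "norm (V x) = sqrt 2 * norm x" for x
    by (simp add: V_def norm_prod_def J(2) real_sqrt_mult)
  ultimately have "sqrt 2 * angle x y \<in> curve_lengths (V ` sphere 0 1) (V x + 0)
      (V (cos (angle x y) *\<^sub>R x + sin (angle x y) *\<^sub>R w) + 0)"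
    using angle_bounds[OF xy] circle_norm[OF xy(1) w]
    by (intro circle_arc_curve_length[OF xy(1) w]) auto
  then show ?thesis using y by (simp add: V_def[abs_def])
qed

text \<open>
  Connectedness by curves of finite length, without which the geodesic distance would be the infimum of the
  empty set. From \<open>(x, y)\<close> turn \<open>y\<close> to a vector \<open>z\<close> orthogonal to both base points, then move the base point
  from \<open>x\<close> to \<open>x'\<close> on a great circle orthogonal to \<open>z\<close>, and finally turn \<open>z\<close> to \<open>y'\<close>.
\<close>
lemma curve_lengths_unit_tangent_bundle_nonempty:
  fixes P Q :: "'a::euclidean_space \<times> 'a"
  assumes dim: "DIM('a) \<ge> 3" and PQ: "P \<in> unit_tangent_bundle" "Q \<in> unit_tangent_bundle"
  shows "curve_lengths unit_tangent_bundle P Q \<noteq> {}"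
proof -
  have fibre: "\<exists>L. L \<in> curve_lengths unit_tangent_bundle (x, y) (x, y')"
    and base: "\<exists>L. L \<in> curve_lengths unit_tangent_bundle (y, x) (y', x)"
    if xyy: "norm x = 1" "norm y = 1" "norm y' = 1" "x \<bullet> y = 0" "x \<bullet> y' = 0" for x y y' :: 'a
  proof -
    have "dim (insert y {x}) < DIM('a)"
      using dim dim_le_card'[of "{y, x}"] card_insert_le_m1[of 2 "{x}" y] by simp
    then obtain w where w: "norm w = 1" "y \<bullet> w = 0" "x \<bullet> w = 0"
      and y': "y' = cos (angle y y') *\<^sub>R y + sin (angle y y') *\<^sub>R w"
      by (rule great_circle_through[of y "{x}" y']) (use xyy in \<open>auto simp: insert_commute\<close>)
    have "1 * angle y y' \<in> curve_lengths unit_tangent_bundle (Pair 0 y + (x, 0))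
        (Pair 0 (cos (angle y y') *\<^sub>R y + sin (angle y y') *\<^sub>R w) + (x, 0))"
      using angle_bounds[OF xyy(2,3)] xyy w circle_norm[OF xyy(2) w(1,2)]
      by (intro circle_arc_curve_length[OF xyy(2) w(1,2)] linearI)
         (auto simp: unit_tangent_bundle_def inner_add_right)
    then show "\<exists>L. L \<in> curve_lengths unit_tangent_bundle (x, y) (x, y')" using y' by auto
    have "1 * angle y y' \<in> curve_lengths unit_tangent_bundle ((\<lambda>z. (z, 0)) y + (0, x))
        ((\<lambda>z. (z, 0)) (cos (angle y y') *\<^sub>R y + sin (angle y y') *\<^sub>R w) + (0, x))"
      using angle_bounds[OF xyy(2,3)] xyy w circle_norm[OF xyy(2) w(1,2)]
      by (intro circle_arc_curve_length[OF xyy(2) w(1,2)] linearI)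
         (auto simp: unit_tangent_bundle_def inner_add_left inner_add_right inner_commute)
    then show "\<exists>L. L \<in> curve_lengths unit_tangent_bundle (y, x) (y', x)" using y' by auto
  qed
  obtain x y x' y' where P: "P = (x, y)" and Q: "Q = (x', y')" by (cases P, cases Q) auto
  have "dim {x, x'} < DIM('a)"
    using dim dim_le_card'[of "{x, x'}"] card_insert_le_m1[of 2 "{x'}" x] by simp
  then obtain z where z: "norm z = 1" "x \<bullet> z = 0" "x' \<bullet> z = 0"
    using unit_vector_orthogonal_to by (metis insertCI)
  have U: "norm x = 1" "norm y = 1" "x \<bullet> y = 0" "norm x' = 1" "norm y' = 1" "x' \<bullet> y' = 0"
    using PQ by (auto simp: P Q unit_tangent_bundle_def)
  obtain L1 L2 L3 where "L1 \<in> curve_lengths unit_tangent_bundle (x, y) (x, z)"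
    "L2 \<in> curve_lengths unit_tangent_bundle (x, z) (x', z)"
    "L3 \<in> curve_lengths unit_tangent_bundle (x', z) (x', y')"
    using fibre[of x y z] base[of z x x'] fibre[of x' z y'] z U by (auto simp: inner_commute)
  then have "L1 + (L2 + L3) \<in> curve_lengths unit_tangent_bundle P Q"
    unfolding P Q by (intro curve_lengths_join)
  then show ?thesis by blast
qed

section \<open>The lower bound for the Lipschitz constant\<close>

text \<open>
  A sphere without a point is contractible, so a map that misses a point is homotopic to a constant,
  and the sphere itself would be contractible.
\<close>
lemma sphere_map_homotopic_to_id_surj:
  fixes g :: "'a::euclidean_space \<Rightarrow> 'a"
  assumes g: "homotopic_with_canon (\<lambda>_. True) (sphere 0 1) (sphere 0 1) g id" and e: "norm e = 1"
  obtains q where "norm q = 1" "g q = e"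
proof (rule ccontr)
  assume "\<not> thesis"
  then have no: "\<And>q. norm q = 1 \<Longrightarrow> g q \<noteq> e" using that by blast
  have cont: "continuous_on (sphere 0 1) g"
    using homotopic_with_imp_continuous[OF g] by simp
  have im: "g ` sphere 0 1 \<subseteq> sphere 0 1 - {e}"
    using homotopic_with_imp_subset1[OF g] no by (auto simp: image_subset_iff)
  have "e \<noteq> 0" using e by auto
  then have "(sphere 0 1 - {e}) homeomorphic {x. e \<bullet> x = 0}"
    using e by (intro homeomorphic_punctured_sphere_hyperplane) auto
  moreover have "contractible {x. e \<bullet> x = 0}"
    by (simp add: convex_imp_contractible convex_hyperplane)
  ultimately have "contractible (sphere 0 1 - {e})"
    using homeomorphic_contractible_eq by blast
  then obtain c where "homotopic_with_canon (\<lambda>_. True) (sphere 0 1) (sphere 0 1 - {e}) g (\<lambda>_. c)"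
    using nullhomotopic_into_contractible[OF cont] im by blast
  then have "homotopic_with_canon (\<lambda>_. True) (sphere 0 1) (sphere 0 1) g (\<lambda>_. c)"
    by (rule homotopic_with_subset_right) auto
  then have "homotopic_with_canon (\<lambda>_. True) (sphere 0 1) (sphere 0 1) id (\<lambda>_. c)"
    using g homotopic_with_symD homotopic_with_trans by blast
  then have "contractible (sphere (0::'a) 1)" by (auto simp: contractible_def)
  then show False by (simp add: contractible_sphere)
qed

text \<open>
  For a projection \<open>P\<close> and a complex structure \<open>K\<close> on the range of \<open>P\<close> the map rotates this range by the angle \<open>s\<close>
  and fixes its orthogonal complement.
\<close>
lemma partial_rotation_homotopic_id:
  fixes K P :: "'a::euclidean_space \<Rightarrow> 'a"
  assumes "linear K" "linear P"
    and norm: "\<And>s x. norm (x - P x + cos s *\<^sub>R P x + sin s *\<^sub>R K x) = norm x"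
  shows "homotopic_with_canon (\<lambda>_. True) (sphere 0 1) (sphere 0 1)
           (\<lambda>x. x - P x + cos s *\<^sub>R P x + sin s *\<^sub>R K x) id"
proof -
  define h where "h z = snd z - P (snd z) + cos (s * (1 - fst z)) *\<^sub>R P (snd z) + sin (s * (1 - fst z)) *\<^sub>R K (snd z)"
    for z :: "real \<times> 'a"
  have lc: "continuous_on A K" "continuous_on A P" for A
    using assms by (auto simp: linear_continuous_on linear_conv_bounded_linear)
  have "continuous_on ({0..1} \<times> sphere 0 1) h"
    unfolding h_def
    by (intro continuous_intros continuous_on_compose2[OF lc(1)[of UNIV]] continuous_on_compose2[OF lc(2)[of UNIV]]) auto
  moreover have "h ` ({0..1} \<times> sphere 0 1) \<subseteq> sphere 0 1" using norm by (auto simp: h_def)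
  ultimately show ?thesis
    unfolding homotopic_with_def by (intro exI[of _ h]) (auto simp: h_def image_subset_iff)
qed

lemma complex_structure_rotation_homotopic_id:
  fixes J :: "'a::euclidean_space \<Rightarrow> 'a"
  assumes J: "linear J" "\<And>x. J (J x) = - x" "\<And>x y. J x \<bullet> y = - (x \<bullet> J y)"
  shows "homotopic_with_canon (\<lambda>_. True) (sphere 0 1) (sphere 0 1) (\<lambda>x. cos s *\<^sub>R x + sin s *\<^sub>R J x) id"
proof -
  have "norm (x - x + cos s *\<^sub>R x + sin s *\<^sub>R J x) = norm x" for s x
  proof -
    have 1: "J x \<bullet> J x = x \<bullet> x" "x \<bullet> J x = 0"
      using J(3)[of x "J x"] J(3)[of x x] J(2)[of x] by (auto simp: inner_commute)
    have "cos s * (cos s * a) + sin s * (sin s * a) = a" for a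
      using sin_cos_squared_add3[of s] by (metis distrib_right mult.assoc mult_1)
    then have "(cos s *\<^sub>R x + sin s *\<^sub>R J x) \<bullet> (cos s *\<^sub>R x + sin s *\<^sub>R J x) = x \<bullet> x"
      using 1 by (simp add: inner_add_left inner_add_right inner_commute)
    then show ?thesis by (simp add: norm_eq)
  qed
  then have "homotopic_with_canon (\<lambda>_. True) (sphere 0 1) (sphere 0 1)
      (\<lambda>x. x - x + cos s *\<^sub>R x + sin s *\<^sub>R J x) id"
    by (intro partial_rotation_homotopic_id J(1) linear_ident)
  then show ?thesis by simp
qed

lemma eq_if_inner_eq_one:
  fixes x y :: "'a::real_inner"
  assumes "norm x = 1" "norm y = 1" "x \<bullet> y = 1"
  shows "x = y"
proof -
  have "(x - y) \<bullet> (x - y) = x \<bullet> x - 2 * (x \<bullet> y) + y \<bullet> y"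
    by (simp only: inner_diff_left inner_diff_right inner_commute[of y x])
  moreover have "x \<bullet> x = 1" "y \<bullet> y = 1" using assms by (simp_all add: dot_square_norm)
  ultimately have "(x - y) \<bullet> (x - y) = 0" using assms(3) by linarith
  then show ?thesis by simp
qed

text \<open>
  The components of a map from the image of a Hopf section to the unit tangent bundle, read on the sphere;
  \<open>J\<close> is the complex structure of the Hopf field.
\<close>
locale frame_map =
  fixes g1 g2 J :: "'a::euclidean_space \<Rightarrow> 'a"
  assumes J: "linear J" "\<And>x. J (J x) = - x" "\<And>x y. J x \<bullet> y = - (x \<bullet> J y)"
    and unit: "\<And>x. norm x = 1 \<Longrightarrow> norm (g1 x) = 1" "\<And>x. norm x = 1 \<Longrightarrow> norm (g2 x) = 1"
    and orth: "\<And>x. norm x = 1 \<Longrightarrow> g1 x \<bullet> g2 x = 0"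
    and g1_id: "homotopic_with_canon (\<lambda>_. True) (sphere 0 1) (sphere 0 1) g1 id"
    and g2_id: "homotopic_with_canon (\<lambda>_. True) (sphere 0 1) (sphere 0 1) g2 id"
begin

lemma minus_homotopic_id:
  "homotopic_with_canon (\<lambda>_. True) (sphere 0 1) (sphere 0 1) (uminus :: 'a \<Rightarrow> 'a) id"
  using complex_structure_rotation_homotopic_id[OF J, of pi] by simp

lemma exists_antipodal:
  obtains p where "norm p = 1" "g1 (- p) = - g1 p"
proof -
  obtain e :: 'a where e: "norm e = 1" using vector_choose_size[of 1] by auto
  show thesis
    by (rule exists_opposite_values_on_involution_orbit[OF _ _ e _ minus_homotopic_id g1_id])
       (auto intro: that linearI simp: orthogonal_transformation_def)
qed

text \<open>
  With \<open>g1 (- p) = - g1 p\<close> and \<open>g2 q = g1 p\<close>, all angles between corresponding components of the images of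
  \<open>q\<close> and \<open>\<plusminus>p\<close> are right, while the angles of \<open>q\<close> with \<open>p\<close> and \<open>- p\<close> add up to \<open>\<pi>\<close>.
\<close>
lemma Lipschitz_constant_ge_one:
  assumes c: "c \<ge> 0" and short: "\<And>x y. norm x = 1 \<Longrightarrow> norm y = 1 \<Longrightarrow>
      (angle (g1 x) (g1 y))\<^sup>2 + (angle (g2 x) (g2 y))\<^sup>2 \<le> 2 * (c * angle x y)\<^sup>2"
  shows "c \<ge> 1"
proof -
  obtain p where p: "norm p = 1" "g1 (- p) = - g1 p" using exists_antipodal .
  obtain q where q: "norm q = 1" "g2 q = g1 p"
    using sphere_map_homotopic_to_id_surj[OF g2_id unit(1)[OF p(1)]] .
  have far: "pi / 2 \<le> c * angle s q" if s: "norm s = 1" "g1 s = g1 p \<or> g1 s = - g1 p" for s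
  proof -
    have "g1 s \<bullet> g1 q = 0" using orth[OF q(1)] q(2) s(2) by (auto simp: inner_commute)
    moreover have "g2 s \<bullet> g2 q = 0" using orth[OF s(1)] q(2) s(2) by (auto simp: inner_commute)
    ultimately have "2 * (pi / 2)\<^sup>2 \<le> 2 * (c * angle s q)\<^sup>2"
      using short[OF s(1) q(1)] by (simp add: angle_orthogonal)
    then have "(pi / 2)\<^sup>2 \<le> (c * angle s q)\<^sup>2" by simp
    then show ?thesis using c angle_bounds[OF s(1) q(1)] by - (rule power2_le_imp_le; simp)
  qed
  have "pi / 2 \<le> c * angle p q" "pi / 2 \<le> c * (pi - angle p q)"
    using far[of p] far[of "- p"] p angle_minus(1)[OF p(1) q(1)] by auto
  then have "pi \<le> c * angle p q + c * (pi - angle p q)" by linarith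
  also have "\<dots> = c * pi" by (simp add: algebra_simps)
  finally have "pi \<le> c * pi" .
  then show ?thesis by simp
qed

end

section \<open>Rigidity for Lipschitz constant one\<close>

text \<open>
  The case of Lipschitz constant 1.
\<close>
locale short_frame_map = frame_map +
  assumes short: "\<And>x y. norm x = 1 \<Longrightarrow> norm y = 1 \<Longrightarrow>
      (angle (g1 x) (g1 y))\<^sup>2 + (angle (g2 x) (g2 y))\<^sup>2 \<le> 2 * (angle x y)\<^sup>2"
begin

text \<open>
  For the point \<open>r\<close> at angle \<open>t\<close> from \<open>p\<close>, the four angles between the images of \<open>p\<close> and \<open>r\<close> and of
  \<open>r\<close> and \<open>q\<close> add up to at most \<open>2 t + 2 (\<pi>/2 - t) = \<pi>\<close> by the Lipschitz condition and to at least \<open>\<pi>\<close> by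
  the triangle inequality in each component. So equality holds throughout, and \<open>g1 r\<close>, \<open>g2 r\<close> lie on the
  quarter circles at the angle \<open>t\<close>.
\<close>
lemma geodesic_rigid:
  assumes p: "norm p = 1" and q: "norm q = 1" and pq: "p \<bullet> q = 0"
    and o: "g1 p \<bullet> g1 q = 0" "g2 p \<bullet> g2 q = 0"
    and ab: "0 \<le> a" "0 \<le> b" "a\<^sup>2 + b\<^sup>2 = 1"
  shows "g1 (a *\<^sub>R p + b *\<^sub>R q) = a *\<^sub>R g1 p + b *\<^sub>R g1 q"
    and "g2 (a *\<^sub>R p + b *\<^sub>R q) = a *\<^sub>R g2 p + b *\<^sub>R g2 q"
proof -
  obtain t where t: "0 \<le> t" "t \<le> pi / 2" "a = cos t" "b = sin t"
    using sincos_total_pi_half[OF ab] by blast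
  define r where "r = a *\<^sub>R p + b *\<^sub>R q"
  have r: "norm r = 1" using circle_norm[OF p q pq] by (simp add: r_def t)
  have "angle p r = t"
    by (rule angle_eqI) (use p q pq t in \<open>auto simp: r_def inner_add_right dot_square_norm\<close>)
  moreover have "angle r q = pi / 2 - t"
    by (rule angle_eqI) (use p q pq t in \<open>auto simp: r_def inner_add_left dot_square_norm cos_diff\<close>)
  ultimately have s1: "(angle (g1 p) (g1 r))\<^sup>2 + (angle (g2 p) (g2 r))\<^sup>2 \<le> 2 * t\<^sup>2"
    and s2: "(angle (g1 r) (g1 q))\<^sup>2 + (angle (g2 r) (g2 q))\<^sup>2 \<le> 2 * (pi / 2 - t)\<^sup>2"
    using short[OF p r] short[OF r q] by auto
  \<comment> \<open>The mean of two numbers is at most their root mean square, with equality only if they agree.\<close>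
  have sum: "u + v \<le> 2 * s" "u + v = 2 * s \<longrightarrow> u = s \<and> v = s"
    if "u\<^sup>2 + v\<^sup>2 \<le> 2 * s\<^sup>2" "0 \<le> s" for u v s :: real
  proof -
    have eq: "(u + v)\<^sup>2 + (u - v)\<^sup>2 = 2 * (u\<^sup>2 + v\<^sup>2)" by (simp add: power2_eq_square algebra_simps)
    have "(u + v)\<^sup>2 + (u - v)\<^sup>2 \<le> (2 * s)\<^sup>2" using that(1) unfolding eq by (simp add: power_mult_distrib)
    then have le: "(u + v)\<^sup>2 + (u - v)\<^sup>2 \<le> (2 * s)\<^sup>2" .
    then show "u + v \<le> 2 * s" using that(2) zero_le_power2[of "u - v"]
      by - (rule power2_le_imp_le; linarith)
    show "u + v = 2 * s \<longrightarrow> u = s \<and> v = s"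
    proof
      assume uv: "u + v = 2 * s"
      then have "(u - v)\<^sup>2 \<le> 0" using le by simp
      then show "u = s \<and> v = s" using uv by simp
    qed
  qed
  have tri1: "pi / 2 \<le> angle (g1 p) (g1 r) + angle (g1 r) (g1 q)"
    and tri2: "pi / 2 \<le> angle (g2 p) (g2 r) + angle (g2 r) (g2 q)"
    using angle_triangle[OF unit(1)[OF p] unit(1)[OF r] unit(1)[OF q]]
      angle_triangle[OF unit(2)[OF p] unit(2)[OF r] unit(2)[OF q]] o
    by (auto simp: angle_orthogonal)
  have "angle (g1 p) (g1 r) + angle (g2 p) (g2 r) = 2 * t"
    "angle (g1 r) (g1 q) + angle (g2 r) (g2 q) = 2 * (pi / 2 - t)"
    using sum(1)[OF s1] sum(1)[OF s2] tri1 tri2 t by auto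
  then have ang: "angle (g1 p) (g1 r) = t" "angle (g2 p) (g2 r) = t"
    "angle (g1 r) (g1 q) = pi / 2 - t" "angle (g2 r) (g2 q) = pi / 2 - t"
    using sum(2)[OF s1] sum(2)[OF s2] t by auto
  have eq: "z = a *\<^sub>R x + b *\<^sub>R y"
    if "norm x = 1" "norm y = 1" "norm z = 1" "x \<bullet> y = 0" "angle x z = t" "angle z y = pi / 2 - t"
    for x y z :: 'a
  proof -
    have "x \<bullet> z = cos t" "y \<bullet> z = sin t"
      using cos_angle[OF that(1,3)] cos_angle[OF that(3,2)] that by (auto simp: cos_diff inner_commute)
    then have "(a *\<^sub>R x + b *\<^sub>R y) \<bullet> z = cos t * cos t + sin t * sin t"
      by (simp only: t inner_add_left inner_scaleR_left)
    then have "(a *\<^sub>R x + b *\<^sub>R y) \<bullet> z = 1" by (simp only: sin_cos_squared_add3)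
    moreover have "norm (a *\<^sub>R x + b *\<^sub>R y) = 1" using circle_norm[OF that(1,2,4)] by (simp add: t)
    ultimately show ?thesis using eq_if_inner_eq_one[OF _ that(3)] by metis
  qed
  show "g1 (a *\<^sub>R p + b *\<^sub>R q) = a *\<^sub>R g1 p + b *\<^sub>R g1 q"
    using eq[OF unit(1)[OF p] unit(1)[OF q] unit(1)[OF r] o(1)] ang by (simp add: r_def)
  show "g2 (a *\<^sub>R p + b *\<^sub>R q) = a *\<^sub>R g2 p + b *\<^sub>R g2 q"
    using eq[OF unit(2)[OF p] unit(2)[OF q] unit(2)[OF r] o(2)] ang by (simp add: r_def)
qed

definition odd_at :: "'a \<Rightarrow> bool" where
  "odd_at p \<longleftrightarrow> norm p = 1 \<and> g1 (- p) = - g1 p \<and> g2 (- p) = - g2 p"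

lemma odd_at_minus: "odd_at p \<Longrightarrow> odd_at (- p)"
  by (auto simp: odd_at_def)

lemma inner_nonpos_if_images_orthogonal:
  assumes s: "norm s = 1" and r: "norm r = 1" and o: "g1 s \<bullet> g1 r = 0" "g2 s \<bullet> g2 r = 0"
  shows "s \<bullet> r \<le> 0"
proof -
  have "(pi / 2)\<^sup>2 \<le> (angle s r)\<^sup>2" using short[OF s r] o by (simp add: angle_orthogonal)
  then have "pi / 2 \<le> angle s r" using angle_bounds[OF s r] by - (rule power2_le_imp_le; simp)
  then have "cos (angle s r) \<le> cos (pi / 2)"
    using angle_bounds[OF s r] by (intro cos_monotone_0_pi_le) auto
  then show ?thesis using cos_angle[OF s r] by simp
qed

lemma orthogonal_if_images_orthogonal:
  assumes "odd_at s" "norm r = 1" "g1 s \<bullet> g1 r = 0" "g2 s \<bullet> g2 r = 0"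
  shows "s \<bullet> r = 0"
  using inner_nonpos_if_images_orthogonal[of s r] inner_nonpos_if_images_orthogonal[of "- s" r] assms
  by (auto simp: odd_at_def)

text \<open>
  Replacing \<open>w\<close> by \<open>- w\<close> reflects both image angles at \<open>\<pi>/2\<close>. If they deviate from \<open>\<pi>/2\<close> by \<open>u\<close> and
  \<open>v\<close>, then the sum of the two Lipschitz conditions says that \<open>u\<^sup>2 + v\<^sup>2 \<le> 0\<close>.
\<close>
lemma images_orthogonal:
  assumes w: "odd_at w" and r: "norm r = 1" and wr: "w \<bullet> r = 0"
  shows "g1 w \<bullet> g1 r = 0" "g2 w \<bullet> g2 r = 0"
proof -
  have w1: "norm w = 1" using w by (simp add: odd_at_def)
  define u where "u = angle (g1 w) (g1 r) - pi / 2"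
  define v where "v = angle (g2 w) (g2 r) - pi / 2"
  have "(pi / 2 + u)\<^sup>2 + (pi / 2 + v)\<^sup>2 \<le> 2 * (pi / 2)\<^sup>2"
    using short[OF w1 r] wr by (simp add: u_def v_def angle_orthogonal)
  moreover have "(pi / 2 - u)\<^sup>2 + (pi / 2 - v)\<^sup>2 \<le> 2 * (pi / 2)\<^sup>2"
  proof -
    have a: "angle (g1 (- w)) (g1 r) = pi / 2 - u" "angle (g2 (- w)) (g2 r) = pi / 2 - v"
      using w angle_minus(1)[OF unit(1)[OF w1] unit(1)[OF r]] angle_minus(1)[OF unit(2)[OF w1] unit(2)[OF r]]
      by (auto simp: odd_at_def u_def v_def)
    have b: "angle (- w) r = pi / 2" using wr by (simp add: angle_orthogonal)
    show ?thesis using short[of "- w" r] w1 r unfolding a b by simp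
  qed
  ultimately have "u\<^sup>2 + v\<^sup>2 \<le> 0" by (simp add: power2_eq_square algebra_simps)
  then have "u = 0" "v = 0" by (auto simp: sum_power2_le_zero_iff)
  then show "g1 w \<bullet> g1 r = 0" "g2 w \<bullet> g2 r = 0"
    using orthogonal_if_angle[OF unit(1)[OF w1] unit(1)[OF r]] orthogonal_if_angle[OF unit(2)[OF w1] unit(2)[OF r]]
    by (auto simp: u_def v_def)
qed

text \<open>
  The extension from the sphere that is homogeneous of degree 1. With it a join of maps becomes a sum,
  and the degenerate cases of a zero summand need no separate treatment.
\<close>
definition radial :: "('a \<Rightarrow> 'a) \<Rightarrow> 'a \<Rightarrow> 'a" where
  "radial g x = norm x *\<^sub>R g (x /\<^sub>R norm x)"

lemma radial_unit: "norm x = 1 \<Longrightarrow> radial g x = g x"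
  by (simp add: radial_def)

lemma radial_zero [simp]: "radial g 0 = 0"
  by (simp add: radial_def)

lemma radial_scale:
  assumes "odd_at p"
  shows "radial g1 (a *\<^sub>R p) = a *\<^sub>R g1 p" "radial g2 (a *\<^sub>R p) = a *\<^sub>R g2 p"
proof -
  have "a *\<^sub>R p /\<^sub>R norm (a *\<^sub>R p) = sgn a *\<^sub>R p"
    using assms by (auto simp: odd_at_def sgn_if)
  moreover have "norm (a *\<^sub>R p) = \<bar>a\<bar>" using assms by (simp add: odd_at_def)
  ultimately show "radial g1 (a *\<^sub>R p) = a *\<^sub>R g1 p" "radial g2 (a *\<^sub>R p) = a *\<^sub>R g2 p"
    using assms by (auto simp: radial_def odd_at_def sgn_if)
qed

text \<open>
  The homogeneous form of \<open>geodesic_rigid\<close>: on orthogonal vectors whose images are orthogonal, the maps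
  are joins.
\<close>
lemma radial_add:
  assumes uv: "u \<bullet> v = 0"
    and o: "u \<noteq> 0 \<Longrightarrow> v \<noteq> 0 \<Longrightarrow> g1 (u /\<^sub>R norm u) \<bullet> g1 (v /\<^sub>R norm v) = 0"
      "u \<noteq> 0 \<Longrightarrow> v \<noteq> 0 \<Longrightarrow> g2 (u /\<^sub>R norm u) \<bullet> g2 (v /\<^sub>R norm v) = 0"
  shows "radial g1 (u + v) = radial g1 u + radial g1 v" "radial g2 (u + v) = radial g2 u + radial g2 v"
proof -
  have "radial g1 (u + v) = radial g1 u + radial g1 v \<and> radial g2 (u + v) = radial g2 u + radial g2 v"
  proof (cases "u = 0 \<or> v = 0")
    case False
    define n where "n = norm (u + v)"
    have n2: "n\<^sup>2 = (norm u)\<^sup>2 + (norm v)\<^sup>2"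
      using uv by (simp add: n_def power2_norm_eq_inner inner_add_left inner_add_right inner_commute)
    have "n \<noteq> 0"
    proof
      assume "n = 0"
      then have "(norm u)\<^sup>2 + (norm v)\<^sup>2 = 0" using n2 by simp
      then show False using False by (simp add: sum_power2_eq_zero_iff)
    qed
    then have n: "n > 0" by (simp add: n_def)
    define a where "a = norm u / n"
    define b where "b = norm v / n"
    have ab: "0 \<le> a" "0 \<le> b" "a\<^sup>2 + b\<^sup>2 = 1"
      using n n2 by (auto simp: a_def b_def power_divide simp flip: add_divide_distrib)
    have "a * inverse (norm u) = inverse n" "b * inverse (norm v) = inverse n"
      using False n by (simp_all add: a_def b_def field_simps)
    then have e: "(u + v) /\<^sub>R n = a *\<^sub>R (u /\<^sub>R norm u) + b *\<^sub>R (v /\<^sub>R norm v)"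
      by (simp add: scaleR_add_right)
    have "g1 ((u + v) /\<^sub>R n) = a *\<^sub>R g1 (u /\<^sub>R norm u) + b *\<^sub>R g1 (v /\<^sub>R norm v)"
      and "g2 ((u + v) /\<^sub>R n) = a *\<^sub>R g2 (u /\<^sub>R norm u) + b *\<^sub>R g2 (v /\<^sub>R norm v)"
      unfolding e using False uv o ab by (intro geodesic_rigid; simp)+
    then show ?thesis
      using n unfolding radial_def n_def[symmetric] by (simp add: scaleR_add_right a_def b_def)
  qed auto
  then show "radial g1 (u + v) = radial g1 u + radial g1 v" "radial g2 (u + v) = radial g2 u + radial g2 v"
    by auto
qed

text \<open>
  Let \<open>e = g1 p\<close> and \<open>y = g2 p\<close>, and let \<open>g2 q = e\<close> and \<open>g2 q' = - e\<close>. As in the proof of the lower bound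
  the images of \<open>\<plusminus>p\<close> are orthogonal to those of \<open>q\<close> and \<open>q'\<close>, now with equality, so \<open>p\<close> is orthogonal to \<open>q\<close>
  and \<open>q'\<close> and the arcs between them go to quarter circles. Orthogonality of \<open>g1\<close> and \<open>g2\<close> at the midpoints of
  these arcs (\<open>cross\<close>) determines the remaining components: \<open>g1 q = - y\<close>, \<open>g2 (- p) = - y\<close> and
  \<open>g1 q' = y\<close>. So the images of \<open>q\<close> and \<open>q'\<close> are opposite, which requires \<open>q' = - q\<close>.
\<close>
lemma antipodal_circle:
  assumes p: "norm p = 1" "g1 (- p) = - g1 p"
  obtains q where "odd_at p" "odd_at q" "p \<bullet> q = 0" "g1 q = - g2 p" "g2 q = g1 p"
proof -
  define e where "e = g1 p"
  define y where "y = g2 p"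
  have ey: "norm e = 1" "norm y = 1" "e \<bullet> y = 0"
    using unit orth p by (auto simp: e_def y_def)
  have pm: "norm (- p) = 1" "g1 (- p) = - e" using p by (auto simp: e_def)
  have perp: "p \<bullet> r = 0" "g1 p \<bullet> g1 r = 0" "g2 p \<bullet> g2 r = 0" "g1 (- p) \<bullet> g1 r = 0" "g2 (- p) \<bullet> g2 r = 0"
    if r: "norm r = 1" "g2 r = e \<or> g2 r = - e" for r
  proof -
    show 1: "g1 p \<bullet> g1 r = 0" "g2 p \<bullet> g2 r = 0" "g1 (- p) \<bullet> g1 r = 0" "g2 (- p) \<bullet> g2 r = 0"
      using orth[OF r(1)] orth[OF p(1)] orth[OF pm(1)] r(2) pm by (auto simp: e_def inner_commute)
    show "p \<bullet> r = 0"
      using inner_nonpos_if_images_orthogonal[OF p(1) r(1)]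
        inner_nonpos_if_images_orthogonal[OF pm(1) r(1)] 1 by simp
  qed
  have cross: "g1 s \<bullet> g2 r + g1 r \<bullet> g2 s = 0"
    if s: "norm s = 1" and r: "norm r = 1" and sr: "s \<bullet> r = 0" "g1 s \<bullet> g1 r = 0" "g2 s \<bullet> g2 r = 0" for s r
  proof -
    \<comment> \<open>\<open>h *\<^sub>R s + h *\<^sub>R r\<close> is the midpoint of the arc from \<open>s\<close> to \<open>r\<close>.\<close>
    define h :: real where "h = 1 / sqrt 2"
    have h: "0 \<le> h" "h\<^sup>2 + h\<^sup>2 = 1" "h \<noteq> 0" by (auto simp: h_def power_divide)
    have "norm (h *\<^sub>R s + h *\<^sub>R r) = 1"
    proof -
      have "s \<bullet> s = 1" "r \<bullet> r = 1" "r \<bullet> s = 0"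
        using s r sr by (simp_all add: dot_square_norm inner_commute)
      then have "(h *\<^sub>R s + h *\<^sub>R r) \<bullet> (h *\<^sub>R s + h *\<^sub>R r) = h\<^sup>2 + h\<^sup>2"
        using sr(1) by (simp add: inner_add_left inner_add_right power2_eq_square)
      then show ?thesis using h by (simp add: norm_eq_1)
    qed
    then have "(h *\<^sub>R g1 s + h *\<^sub>R g1 r) \<bullet> (h *\<^sub>R g2 s + h *\<^sub>R g2 r) = 0"
      using orth geodesic_rigid[OF s r sr h(1,1,2)] by metis
    then have "(h * h) * (g1 s \<bullet> g2 r + g1 r \<bullet> g2 s) = 0"
      using orth[OF s] orth[OF r] by (simp add: inner_add_left inner_add_right algebra_simps)
    then show ?thesis using h(3) by simp
  qed
  obtain q where q: "norm q = 1" "g2 q = e"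
    using sphere_map_homotopic_to_id_surj[OF g2_id ey(1)] .
  obtain q' where q': "norm q' = 1" "g2 q' = - e"
    using sphere_map_homotopic_to_id_surj[OF g2_id, of "- e"] ey(1) by auto
  have g1q: "g1 q = - y"
  proof -
    have "1 + g1 q \<bullet> y = 0"
      using cross[OF p(1) q(1)] perp[OF q(1)] q(2) ey by (simp add: e_def y_def dot_square_norm)
    then show ?thesis
      using eq_if_inner_eq_one[of "g1 q" "- y"] unit(1)[OF q(1)] ey by simp
  qed
  have g2p: "g2 (- p) = - y"
  proof -
    have "- 1 + g1 q \<bullet> g2 (- p) = 0"
      using cross[OF pm(1) q(1)] perp[OF q(1)] q(2) ey pm by (simp add: dot_square_norm)
    then show ?thesis
      using eq_if_inner_eq_one[of "g2 (- p)" "- y"] unit(2)[OF pm(1)] ey g1q by (simp add: inner_commute)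
  qed
  have g1q': "g1 q' = y"
  proof -
    have "- 1 + g1 q' \<bullet> y = 0"
      using cross[OF p(1) q'(1)] perp[OF q'(1)] q'(2) ey by (simp add: e_def y_def dot_square_norm)
    then show ?thesis
      using eq_if_inner_eq_one[of "g1 q'" "y"] unit(1)[OF q'(1)] ey by simp
  qed
  have "q' = - q"
  proof (rule eq_minus_if_angle_pi[OF q(1) q'(1)])
    have "angle (g1 q) (g1 q') = pi" "angle (g2 q) (g2 q') = pi"
      using g1q g1q' q(2) q'(2) ey by (auto simp: angle_def dot_square_norm)
    then have "pi\<^sup>2 \<le> (angle q q')\<^sup>2" using short[OF q(1) q'(1)] by simp
    then show "pi \<le> angle q q'" using angle_bounds[OF q(1) q'(1)] by - (rule power2_le_imp_le; simp)
  qed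
  then have "odd_at q" using q q' g1q g1q' by (simp add: odd_at_def)
  moreover have "odd_at p" using p g2p by (simp add: odd_at_def y_def)
  ultimately show thesis
    using that perp(1)[OF q(1)] q(2) g1q by (simp add: e_def y_def)
qed

text \<open>
  The subspace on which \<open>g1\<close> and \<open>g2\<close> are already known to be linear is \<open>W = range K\<close>, and it is encoded in \<open>K\<close>
  alone: \<open>K\<close> is a complex structure on \<open>W\<close> and vanishes on the orthogonal complement of \<open>W\<close>, so that \<open>- K \<circ> K\<close> is
  the orthogonal projection to \<open>W\<close> and \<open>w \<in> W\<close> is expressed by \<open>K (K w) = - w\<close>. Likewise \<open>A\<close> is isometric
  on \<open>W\<close> and vanishes on the complement. In this form the extension by a plane is the addition of explicit rank 2 terms.
\<close>
definition linear_part :: "('a \<Rightarrow> 'a) \<Rightarrow> ('a \<Rightarrow> 'a) \<Rightarrow> bool" where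
  "linear_part K A \<longleftrightarrow> linear K \<and> linear A \<and> (\<forall>x y. K x \<bullet> y = - (x \<bullet> K y)) \<and>
     (\<forall>x. K (K (K x)) = - K x) \<and> (\<forall>x y. A x \<bullet> A y = K x \<bullet> K y) \<and>
     (\<forall>x. norm x = 1 \<longrightarrow> K (K x) = - x \<longrightarrow> g1 x = A x \<and> g2 x = A (K x))"

text \<open>
  Find a plane in the kernel of \<open>K\<close> on which \<open>g1\<close> and \<open>g2\<close> are linear, by \<open>antipodal_circle\<close>. The antipodal point
  \<open>p\<close> comes from the involution \<open>\<tau>\<close> that is 1 on \<open>W\<close> and \<open>-1\<close> on \<open>ker K\<close>. It is homotopic to the identity: \<open>- \<tau>\<close> is
  a rotation of \<open>W\<close> by \<open>\<pi>\<close>, and the antipodal map is a rotation of the whole space by \<open>\<pi>\<close>.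
\<close>
lemma linear_part_extend:
  assumes KA: "linear_part K A" and p0: "K p0 = 0" "p0 \<noteq> 0"
  obtains K' A' where "linear_part K' A'" "dim (range K) < dim (range K')"
proof -
  have linK: "linear K" and linA: "linear A" and skew: "\<And>x y. K x \<bullet> y = - (x \<bullet> K y)"
    and K3: "\<And>x. K (K (K x)) = - K x" and AK: "\<And>x y. A x \<bullet> A y = K x \<bullet> K y"
    and gA: "\<And>x. norm x = 1 \<Longrightarrow> K (K x) = - x \<Longrightarrow> g1 x = A x" "\<And>x. norm x = 1 \<Longrightarrow> K (K x) = - x \<Longrightarrow> g2 x = A (K x)"
    using KA unfolding linear_part_def by blast+
  note linear_simps = linear_add[OF linK] linear_scale[OF linK] linear_diff[OF linK] linear_neg[OF linK] linear_0[OF linK]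
    linear_add[OF linA] linear_scale[OF linA] linear_diff[OF linA] linear_neg[OF linA] linear_0[OF linA]
  define P where "P x = - K (K x)" for x
  have linP: "linear P" unfolding P_def using linK
    by (intro linearI) (auto simp: linear_simps)
  have KP: "K (P x) = K x" and PP: "P (P x) = P x" and KU: "K (x - P x) = 0" for x
    by (simp_all add: P_def linear_simps K3)
  have KK: "K x \<bullet> K y = P x \<bullet> y" for x y using skew[of "K x" y] by (simp add: P_def)
  have W_U: "w \<bullet> u = 0" if "K (K w) = - w" "K u = 0" for w u
  proof -
    have "w \<bullet> u = - (K (K w) \<bullet> u)" using that(1) by simp
    also have "\<dots> = K w \<bullet> K u" by (simp add: skew[of "K w" u])
    finally show ?thesis using that(2) by simp
  qed
  have PW: "K (K (P x)) = - P x" for x by (simp add: P_def linear_simps K3)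
  have AP: "A x = A (P x)" for x
  proof -
    have "A (x - P x) \<bullet> A (x - P x) = 0" by (simp add: AK KU)
    then show ?thesis by (simp add: linear_simps)
  qed
  have oddW: "odd_at w" if "norm w = 1" "K (K w) = - w" for w
    using that gA[OF that] gA[of "- w"] by (simp add: odd_at_def linear_simps)
  have radialW: "radial g1 w = A w" "radial g2 w = A (K w)" if "K (K w) = - w" for w
  proof -
    have "radial g1 w = A w \<and> radial g2 w = A (K w)"
    proof (cases "w = 0")
      case False
      have "norm (w /\<^sub>R norm w) = 1" "K (K (w /\<^sub>R norm w)) = - (w /\<^sub>R norm w)"
        using False that by (auto simp: linear_simps)
      then show ?thesis using False gA by (simp add: radial_def linear_simps)
    qed (simp add: linear_simps)
    then show "radial g1 w = A w" "radial g2 w = A (K w)" by auto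
  qed
  have radial_split: "radial g1 (w + u) = A w + radial g1 u" "radial g2 (w + u) = A (K w) + radial g2 u"
    if w: "K (K w) = - w" and u: "K u = 0" for w u
  proof -
    have o: "g1 (w /\<^sub>R norm w) \<bullet> g1 (u /\<^sub>R norm u) = 0" "g2 (w /\<^sub>R norm w) \<bullet> g2 (u /\<^sub>R norm u) = 0"
      if "w \<noteq> 0" "u \<noteq> 0"
      using that w W_U[OF w u] by (intro images_orthogonal oddW; simp add: linear_simps)+
    show "radial g1 (w + u) = A w + radial g1 u" "radial g2 (w + u) = A (K w) + radial g2 u"
      using radial_add[OF W_U[OF w u] o] radialW[OF w] by auto
  qed
  \<comment> \<open>A point whose image under \<open>\<tau>\<close> has the opposite value lies in the kernel of \<open>K\<close>, where \<open>\<tau>\<close> is the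
    antipodal map: on its part \<open>w\<close> in \<open>W\<close> both values have the same component \<open>A w\<close>, which must vanish.\<close>
  obtain p where p: "norm p = 1" "K p = 0" "g1 (- p) = - g1 p"
  proof -
    define \<tau> where "\<tau> x = 2 *\<^sub>R P x - x" for x
    define e where "e = p0 /\<^sub>R norm p0"
    have e: "norm e = 1" "K e = 0" using p0 by (auto simp: e_def linear_simps)
    then have tau_e: "\<tau> e = - e" by (simp add: \<tau>_def P_def linear_simps)
    have tau_tau: "\<tau> (\<tau> x) = x" for x
    proof -
      have "P (\<tau> x) = P x"
        by (simp add: \<tau>_def linear_diff[OF linP] linear_scale[OF linP] linear_add[OF linP] PP scaleR_2)
      then show ?thesis unfolding \<tau>_def[of "\<tau> x"] by (simp add: \<tau>_def)
    qed
    have rot: "norm (x - P x + cos s *\<^sub>R P x + sin s *\<^sub>R K x) = norm x" for s x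
    proof -
      have 1: "(x - P x) \<bullet> P x = 0" "(x - P x) \<bullet> K x = 0"
        using W_U[OF PW KU, of x x] W_U[of "K x" "x - P x"] KU K3 by (auto simp: inner_commute)
      have 2: "P x \<bullet> K x = 0" "K x \<bullet> K x = P x \<bullet> P x"
        using skew[of x x] skew[of "P x" "P x"] KP KK[of x "P x"] KK[of x x] KK[of "P x" "P x"] PP
        by (auto simp: inner_commute)
      define u where "u = x - P x"
      have "cos s * (cos s * a) + sin s * (sin s * a) = a" for a
        using sin_cos_squared_add3[of s] by (metis distrib_right mult.assoc mult_1)
      then have "(u + cos s *\<^sub>R P x + sin s *\<^sub>R K x) \<bullet> (u + cos s *\<^sub>R P x + sin s *\<^sub>R K x)
        = u \<bullet> u + P x \<bullet> P x"
        using 1 2 unfolding u_def[symmetric]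
        by (simp add: inner_add_left inner_add_right inner_commute)
      also have "\<dots> = (u + P x) \<bullet> (u + P x)"
        using 1 unfolding u_def[symmetric] by (simp add: inner_add_left inner_add_right inner_commute)
      finally show ?thesis by (simp add: norm_eq u_def)
    qed
    have "homotopic_with_canon (\<lambda>_. True) (sphere 0 1) (sphere 0 1)
        (uminus \<circ> (\<lambda>x. x - P x + cos pi *\<^sub>R P x + sin pi *\<^sub>R K x)) (uminus \<circ> id)"
      by (rule homotopic_with_compose_continuous_left[OF partial_rotation_homotopic_id[OF linK linP rot]])
         (auto intro!: continuous_intros)
    then have "homotopic_with_canon (\<lambda>_. True) (sphere 0 1) (sphere 0 1) \<tau> uminus"
      by (rule homotopic_with_eq) (auto simp: \<tau>_def scaleR_2)
    then have tau_id: "homotopic_with_canon (\<lambda>_. True) (sphere 0 1) (sphere 0 1) \<tau> id"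
      by (rule homotopic_with_trans[OF _ minus_homotopic_id])
    have "norm (\<tau> x) = norm x" for x
      using rot[of x pi] by (simp add: \<tau>_def scaleR_2) (metis (no_types) diff_diff_eq norm_minus_commute)
    moreover have "linear \<tau>"
      unfolding \<tau>_def by (intro linearI) (auto simp: linear_add[OF linP] linear_scale[OF linP] algebra_simps)
    ultimately have "orthogonal_transformation \<tau>" by (simp add: orthogonal_transformation)
    then obtain x where x: "norm x = 1" "g1 (\<tau> x) = - g1 x"
      using exists_opposite_values_on_involution_orbit[OF _ tau_tau e(1) tau_e tau_id g1_id] by metis
    define w where "w = P x"
    define u where "u = x - P x"
    have wu: "K (K w) = - w" "K u = 0" "K (- u) = 0" "x = w + u" "\<tau> x = w + - u"
      by (simp_all add: w_def u_def KP \<tau>_def scaleR_2 linear_simps) (simp add: P_def)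
    have "norm (\<tau> x) = 1" using \<open>\<And>x. norm (\<tau> x) = norm x\<close> x by simp
    then have "g1 (\<tau> x) = A w + radial g1 (- u)" and "g1 x = A w + radial g1 u"
      using radial_split(1)[OF wu(1,3)] radial_split(1)[OF wu(1,2)] x(1) wu(4,5) radial_unit by metis+
    then have "2 *\<^sub>R A w + radial g1 (- u) + radial g1 u = g1 (\<tau> x) + g1 x"
      by (simp add: scaleR_2)
    then have eq: "2 *\<^sub>R A w + radial g1 (- u) + radial g1 u = 0" by (simp add: x(2))
    have perp: "A w \<bullet> radial g1 u' = 0" if "K u' = 0" for u'
    proof (cases "w = 0 \<or> u' = 0")
      case False
      then have "g1 (w /\<^sub>R norm w) \<bullet> g1 (u' /\<^sub>R norm u') = 0"
        using wu(1) W_U[OF wu(1) that] by (intro images_orthogonal oddW) (auto simp: linear_simps)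
      then show ?thesis unfolding radialW(1)[OF wu(1), symmetric] by (simp add: radial_def)
    qed (auto simp: linear_simps)
    have "A w \<bullet> (2 *\<^sub>R A w + radial g1 (- u) + radial g1 u) = 2 * (A w \<bullet> A w)"
      using perp[OF wu(2)] perp[OF wu(3)] by (simp add: inner_add_right)
    then have "A w \<bullet> A w = 0" unfolding eq by simp
    then have "K w = 0" by (simp add: AK)
    then have "K x = 0" using KP[of x] by (simp add: w_def)
    then show thesis using that[of x] x by (simp add: \<tau>_def P_def linear_simps)
  qed
  obtain q where q: "odd_at p" "odd_at q" "p \<bullet> q = 0" "g1 q = - g2 p" "g2 q = g1 p"
    using antipodal_circle[OF p(1,3)] .
  define e where "e = g1 p"
  define y where "y = g2 p"
  have ey: "e \<bullet> e = 1" "y \<bullet> y = 1" "e \<bullet> y = 0" "y \<bullet> e = 0"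
    using unit[OF p(1)] orth[OF p(1)] by (auto simp: e_def y_def dot_square_norm inner_commute)
  have pq: "p \<bullet> p = 1" "q \<bullet> q = 1" "p \<bullet> q = 0" "q \<bullet> p = 0"
    using q by (auto simp: odd_at_def dot_square_norm inner_commute)
  \<comment> \<open>The new plane is orthogonal to \<open>W\<close>, and so are the images.\<close>
  have eW: "A w \<bullet> e = 0" and yW: "A w \<bullet> y = 0" if w: "norm w = 1" "K (K w) = - w" for w
  proof -
    have wp: "w \<bullet> p = 0" and "K w \<bullet> p = 0" using W_U[of _ p] w p by (auto simp: linear_simps)
    show "A w \<bullet> e = 0"
      using images_orthogonal(1)[OF oddW[OF w] p(1) wp] gA(1)[OF w] by (simp add: e_def)
    have w': "norm (- K w) = 1" "K (K (- K w)) = - (- K w)"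
      using w skew[of w "K w"] by (auto simp: norm_eq_1 linear_simps)
    have "g2 (- K w) = A w" using gA(2)[OF w'] w by (simp add: linear_simps)
    moreover have "- K w \<bullet> p = 0" using \<open>K w \<bullet> p = 0\<close> by simp
    ultimately show "A w \<bullet> y = 0"
      using images_orthogonal(2)[OF oddW[OF w'] p(1)] by (simp add: y_def)
  qed
  have A_perp: "A x \<bullet> e = 0" "A x \<bullet> y = 0" for x
  proof -
    have "A x \<bullet> e = 0 \<and> A x \<bullet> y = 0"
    proof (cases "P x = 0")
      case True
      then show ?thesis using AP[of x] by (simp add: linear_simps)
    next
      case False
      define w where "w = P x /\<^sub>R norm (P x)"
      have w: "norm w = 1" "K (K w) = - w" using False PW[of x] by (auto simp: w_def linear_simps)
      have "A x = norm (P x) *\<^sub>R A w" using False AP[of x] by (simp add: w_def linear_simps)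
      then show ?thesis using eW[OF w] yW[OF w] by simp
    qed
    then show "A x \<bullet> e = 0" "A x \<bullet> y = 0" by auto
  qed
  have Kq: "K q = 0"
  proof -
    have "w \<bullet> q = 0" if w: "norm w = 1" "K (K w) = - w" for w
      using orthogonal_if_images_orthogonal[OF oddW[OF w], of q] q gA[OF w] A_perp
      by (auto simp: odd_at_def e_def y_def)
    then have "K x \<bullet> q = 0" for x
    proof (cases "K x = 0")
      case False
      have "norm (K x /\<^sub>R norm (K x)) = 1" "K (K (K x /\<^sub>R norm (K x))) = - (K x /\<^sub>R norm (K x))"
        using False K3 by (auto simp: linear_simps)
      then have "(K x /\<^sub>R norm (K x)) \<bullet> q = 0" using \<open>\<And>w. norm w = 1 \<Longrightarrow> K (K w) = - w \<Longrightarrow> w \<bullet> q = 0\<close> by blast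
      then show ?thesis using False by simp
    qed simp
    then have "K q \<bullet> K q = 0" using skew[of "K q" q] K3 by (metis inner_commute neg_equal_0_iff_equal)
    then show ?thesis by simp
  qed
  have Kpq: "K x \<bullet> p = 0" "K x \<bullet> q = 0" for x
    using skew[of x p] skew[of x q] p(2) Kq by auto
  \<comment> \<open>\<open>A p = g1 p = e\<close> and \<open>A q = g1 q = - y\<close>, and \<open>g2 = A \<circ> K\<close> then dictates \<open>K p = - q\<close> and \<open>K q = p\<close>.\<close>
  define K' where "K' x = K x + (x \<bullet> q) *\<^sub>R p - (x \<bullet> p) *\<^sub>R q" for x
  define A' where "A' x = A x + (x \<bullet> p) *\<^sub>R e - (x \<bullet> q) *\<^sub>R y" for x
  have K'K': "K' (K' x) = K (K x) - (x \<bullet> p) *\<^sub>R p - (x \<bullet> q) *\<^sub>R q" for x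
    using pq p(2) Kq Kpq by (simp add: K'_def linear_simps inner_add_left inner_diff_left)
  have "linear_part K' A'"
    unfolding linear_part_def
  proof (intro conjI allI impI)
    show "linear K'" "linear A'"
      by (auto intro!: linearI simp: K'_def A'_def linear_simps inner_add_left algebra_simps)
    show "K' x \<bullet> y' = - (x \<bullet> K' y')" for x y'
      using skew[of x y'] by (simp add: K'_def inner_add_left inner_add_right inner_diff_left inner_diff_right inner_commute)
    show "K' (K' (K' x)) = - K' x" for x
      unfolding K'K' using pq Kpq K3[of x] p(2) Kq
      by (simp add: K'_def linear_simps inner_add_left inner_diff_left)
    show "A' x \<bullet> A' z = K' x \<bullet> K' z" for x z
      using AK[of x z] A_perp[of x] A_perp[of z] ey pq Kpq[of x] Kpq[of z]
      by (simp add: K'_def A'_def inner_add_left inner_add_right inner_diff_left inner_diff_right inner_commute)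
    fix x assume x: "norm x = 1" "K' (K' x) = - x"
    define w where "w = P x"
    define z where "z = (x \<bullet> p) *\<^sub>R p + (x \<bullet> q) *\<^sub>R q"
    have xwz: "x = w + z" using x(2) unfolding K'K' w_def z_def P_def by (simp add: algebra_simps)
    have w: "K (K w) = - w" by (simp add: w_def PW)
    have z: "K z = 0" using p(2) Kq by (simp add: z_def linear_simps)
    have rz: "radial g1 z = (x \<bullet> p) *\<^sub>R e - (x \<bullet> q) *\<^sub>R y" "radial g2 z = (x \<bullet> p) *\<^sub>R y + (x \<bullet> q) *\<^sub>R e"
    proof -
      have a: "odd_at (c *\<^sub>R p /\<^sub>R norm (c *\<^sub>R p))" if "c \<noteq> 0" for c :: real
        using that q(1) odd_at_minus[OF q(1)] by (cases "c > 0") (auto simp: odd_at_def)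
      have "((x \<bullet> p) *\<^sub>R p) \<bullet> ((x \<bullet> q) *\<^sub>R q) = 0" using pq by simp
      note add = radial_add[OF this images_orthogonal(1)[OF a] images_orthogonal(2)[OF a]]
      have "norm q = 1" using q(2) by (simp add: odd_at_def)
      show "radial g1 z = (x \<bullet> p) *\<^sub>R e - (x \<bullet> q) *\<^sub>R y"
        unfolding z_def
        by (subst add) (use radial_scale[OF q(1)] radial_scale[OF q(2)] q pq \<open>norm q = 1\<close> in \<open>auto simp: e_def y_def abs_mult\<close>)
      show "radial g2 z = (x \<bullet> p) *\<^sub>R y + (x \<bullet> q) *\<^sub>R e"
        unfolding z_def
        by (subst add) (use radial_scale[OF q(1)] radial_scale[OF q(2)] q pq \<open>norm q = 1\<close> in \<open>auto simp: e_def y_def abs_mult\<close>)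
    qed
    have "g1 x = A w + radial g1 z"
      using radial_split(1)[OF w z] radial_unit[OF x(1), of g1] xwz by simp
    then show "g1 x = A' x" using rz AP[of x] by (simp add: A'_def w_def)
    have "g2 x = A (K w) + radial g2 z"
      using radial_split(2)[OF w z] radial_unit[OF x(1), of g2] xwz by simp
    moreover have "A' (K' x) = A (K w) + (x \<bullet> q) *\<^sub>R e + (x \<bullet> p) *\<^sub>R y"
    proof -
      have "K' x \<bullet> p = x \<bullet> q" "K' x \<bullet> q = - (x \<bullet> p)"
        using pq Kpq by (auto simp: K'_def inner_add_left inner_diff_left)
      moreover have "A (K' x) = A (K w)"
      proof -
        have "A p = 0" "A q = 0" using AK[of p p] AK[of q q] p(2) Kq by auto
        then show ?thesis by (simp add: K'_def linear_simps w_def KP)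
      qed
      ultimately show ?thesis by (simp add: A'_def)
    qed
    ultimately show "g2 x = A' (K' x)" using rz by simp
  qed
  moreover have "dim (range K) < dim (range K')"
  proof (rule dim_psubset)
    have sub: "subspace (range K)" "subspace (range K')"
      using linK \<open>linear_part K' A'\<close> by (auto simp: linear_part_def linear_subspace_image subspace_UNIV)
    have "K x = K' (P x)" for x
    proof -
      have "P x \<bullet> p = 0" "P x \<bullet> q = 0" using Kpq by (auto simp: P_def)
      then show ?thesis by (simp add: K'_def KP)
    qed
    then have "range K \<subseteq> range K'" by auto
    moreover have "p \<in> range K'"
    proof -
      have "K' q = p" using pq Kq by (simp add: K'_def)
      then show ?thesis by (metis rangeI)
    qed
    moreover have "p \<notin> range K" using Kpq(1) pq(1) by auto
    ultimately show "span (range K) \<subset> span (range K')" using sub by (auto simp: span_eq_iff[THEN iffD2])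
  qed
  ultimately show thesis using that by blast
qed

text \<open>
  A linear part of maximal rank is defined on the whole space.
\<close>
lemma linear_frame_map:
  "\<exists>K A. linear K \<and> (\<forall>x. K (K x) = - x) \<and> (\<forall>x y. K x \<bullet> y = - (x \<bullet> K y)) \<and>
     linear A \<and> (\<forall>x. norm (A x) = norm x) \<and> (\<forall>x. norm x = 1 \<longrightarrow> g1 x = A x \<and> g2 x = A (K x))"
proof -
  define good where "good k \<longleftrightarrow> (\<exists>K A. linear_part K A \<and> dim (range K) = k)" for k
  have "linear_part (\<lambda>_. 0) (\<lambda>_. 0)"
    by (auto simp: linear_part_def intro!: linearI)
  then have "\<exists>k. good k" by (auto simp: good_def)
  moreover have "k \<le> DIM('a)" if "good k" for k using that by (auto simp: good_def dim_subset_UNIV)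
  ultimately obtain k where k: "good k" "\<And>j. good j \<Longrightarrow> j \<le> k"
    using Nat.ex_has_greatest_nat[of good _ "DIM('a)"] by metis
  then obtain K A where KA: "linear_part K A" "dim (range K) = k" by (auto simp: good_def)
  have inj: "p = 0" if p: "K p = 0" for p
  proof (rule ccontr)
    assume "p \<noteq> 0"
    then obtain K' A' where "linear_part K' A'" "dim (range K) < dim (range K')"
      using linear_part_extend[OF KA(1) p] by metis
    then show False using k(2)[of "dim (range K')"] KA(2) by (auto simp: good_def)
  qed
  have linK: "linear K" and K3: "K (K (K x)) = - K x" and skew: "K x \<bullet> y = - (x \<bullet> K y)"
    and AK: "A x \<bullet> A y = K x \<bullet> K y" for x y
    using KA(1) by (auto simp: linear_part_def)
  have K2: "K (K x) = - x" for x
    using inj[of "K (K x) + x"] K3[of x] by (simp add: linear_add[OF linK] eq_neg_iff_add_eq_0)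
  have "norm (A x) = norm x" for x
    using AK[of x x] skew[of x "K x"] K2[of x] by (simp add: norm_eq)
  then show ?thesis
    using KA(1) K2 unfolding linear_part_def by (intro exI[of _ K] exI[of _ A]) blast
qed

end

section \<open>Conjugacy of orthogonal complex structures\<close>

text \<open>
  Take a partial isometry \<open>C\<close> of maximal rank that intertwines \<open>K\<close> and \<open>J\<close> on a \<open>K\<close>-invariant subspace,
  represented by the orthogonal projection \<open>Q\<close> to it, and vanishes on the complement. If \<open>p\<close> is a unit vector in the
  kernel of \<open>Q\<close> and \<open>c\<close> one orthogonal to the range of \<open>C\<close>, then \<open>C\<close> extends by \<open>p \<mapsto> c\<close> and
  \<open>K p \<mapsto> J c\<close>.
\<close>
lemma orthogonal_complex_structures_conjugate:
  fixes J K :: "'a::euclidean_space \<Rightarrow> 'a"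
  assumes J: "linear J" "\<And>x. J (J x) = - x" "\<And>x y. J x \<bullet> y = - (x \<bullet> J y)"
    and K: "linear K" "\<And>x. K (K x) = - x" "\<And>x y. K x \<bullet> y = - (x \<bullet> K y)"
  shows "\<exists>C. linear C \<and> (\<forall>x. norm (C x) = norm x) \<and> (\<forall>x. C (K x) = J (C x))"
proof -
  define part where "part Q C \<longleftrightarrow> linear Q \<and> linear C \<and> (\<forall>x. Q (Q x) = Q x) \<and> (\<forall>x y. Q x \<bullet> y = x \<bullet> Q y) \<and>
     (\<forall>x. Q (K x) = K (Q x)) \<and> (\<forall>x y. C x \<bullet> C y = Q x \<bullet> y) \<and> (\<forall>x. C (K x) = J (C x))"
    for Q C :: "'a \<Rightarrow> 'a"
  define good where "good k \<longleftrightarrow> (\<exists>Q C. part Q C \<and> dim (range Q) = k)" for k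
  have "part (\<lambda>_. 0) (\<lambda>_. 0)"
    using J(1) K(1) by (auto simp: part_def linear_0 intro!: linearI)
  then have "\<exists>k. good k" by (auto simp: good_def)
  moreover have "k \<le> DIM('a)" if "good k" for k using that by (auto simp: good_def dim_subset_UNIV)
  ultimately obtain k where k: "good k" "\<And>j. good j \<Longrightarrow> j \<le> k"
    using Nat.ex_has_greatest_nat[of good _ "DIM('a)"] by metis
  then obtain Q C where QC: "part Q C" "dim (range Q) = k" by (auto simp: good_def)
  have linQ: "linear Q" and linC: "linear C" and QQ: "Q (Q x) = Q x" and Qsym: "Q x \<bullet> y = x \<bullet> Q y"
    and QK: "Q (K x) = K (Q x)" and CQ: "C x \<bullet> C y = Q x \<bullet> y" and CK: "C (K x) = J (C x)" for x y
    using QC(1) by (auto simp: part_def)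
  note linear_simps = linear_add[OF linQ] linear_scale[OF linQ] linear_diff[OF linQ] linear_neg[OF linQ] linear_0[OF linQ]
    linear_add[OF linC] linear_scale[OF linC] linear_diff[OF linC] linear_neg[OF linC] linear_0[OF linC]
    linear_add[OF J(1)] linear_scale[OF J(1)] linear_neg[OF J(1)] linear_0[OF J(1)]
    linear_add[OF K(1)] linear_scale[OF K(1)] linear_neg[OF K(1)] linear_0[OF K(1)]
  have inj: "p0 = 0" if p0: "Q p0 = 0" for p0
  proof (rule ccontr)
    assume "p0 \<noteq> 0"
    define p where "p = p0 /\<^sub>R norm p0"
    define q where "q = K p"
    have Qp: "Q p = 0" and Qq: "Q q = 0" using p0 by (auto simp: p_def q_def QK linear_simps)
    have "norm p = 1" using \<open>p0 \<noteq> 0\<close> by (simp add: p_def)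
    then have pq: "p \<bullet> p = 1" "q \<bullet> q = 1" "p \<bullet> q = 0" "q \<bullet> p = 0"
      using K(3)[of p "K p"] K(3)[of p p] K(2)[of p]
      by (auto simp: q_def dot_square_norm inner_commute)
    have "\<not> surj C"
    proof
      assume "surj C"
      then have "inj C" using linear_surjective_imp_injective[OF linC] by blast
      moreover have "C p = C 0" using CQ[of p p] Qp by (simp add: linear_simps)
      ultimately have "p = 0" by (rule injD)
      then show False using pq(1) by simp
    qed
    have "subspace (range C)" using linC by (simp add: linear_subspace_image)
    then have "dim (range C) < DIM('a)"
      using \<open>\<not> surj C\<close> dim_eq_full[of "range C"] dim_subset_UNIV[of "range C"]
      by (metis le_neq_implies_less span_eq_iff)
    then obtain c where c: "norm c = 1" "\<And>u. u \<in> range C \<Longrightarrow> u \<bullet> c = 0"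
      using unit_vector_orthogonal_to by metis
    have Cc: "C x \<bullet> c = 0" "c \<bullet> C x = 0" for x
      using c(2)[of "C x"] by (simp_all add: inner_commute)
    have CJc: "C x \<bullet> J c = 0" "J c \<bullet> C x = 0" for x
      using J(3)[of c "C x"] Cc(2)[of "K x"] by (auto simp: CK inner_commute)
    have cc: "c \<bullet> c = 1" "J c \<bullet> J c = 1" "c \<bullet> J c = 0" "J c \<bullet> c = 0"
      using c(1) J(3)[of c "J c"] J(3)[of c c] J(2)[of c] by (auto simp: dot_square_norm inner_commute)
    define Q' where "Q' x = Q x + (x \<bullet> p) *\<^sub>R p + (x \<bullet> q) *\<^sub>R q" for x
    define C' where "C' x = C x + (x \<bullet> p) *\<^sub>R c + (x \<bullet> q) *\<^sub>R J c" for x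
    have Qpq: "Q x \<bullet> p = 0" "Q x \<bullet> q = 0" for x using Qsym[of x] Qp Qq by auto
    have Kx: "K x \<bullet> p = - (x \<bullet> q)" "K x \<bullet> q = x \<bullet> p" for x
      using K(3)[of x p] K(3)[of x q] K(2)[of p] by (auto simp: q_def)
    have "part Q' C'"
      unfolding part_def
    proof (intro conjI allI)
      show "linear Q'" "linear C'"
        by (auto intro!: linearI simp: Q'_def C'_def linear_simps inner_add_left algebra_simps)
      show "Q' (Q' x) = Q' x" for x
        using pq Qpq Qp Qq by (simp add: Q'_def linear_simps QQ inner_add_left)
      show "Q' x \<bullet> y = x \<bullet> Q' y" for x y
        using Qsym[of x y] by (simp add: Q'_def inner_add_left inner_add_right inner_commute)
      show "Q' (K x) = K (Q' x)" for x
      proof -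
        have "K p = q" "K q = - p" using K(2)[of p] by (simp_all add: q_def)
        then show ?thesis by (simp add: Q'_def linear_simps QK Kx)
      qed
      show "C' x \<bullet> C' y = Q' x \<bullet> y" for x y
        using CQ[of x y] Cc CJc cc
        by (simp add: Q'_def C'_def inner_add_left inner_add_right inner_commute)
      show "C' (K x) = J (C' x)" for x
        by (simp add: C'_def linear_simps CK Kx J(2))
    qed
    moreover have "dim (range Q) < dim (range Q')"
    proof (rule dim_psubset)
      have sub: "subspace (range Q)" "subspace (range Q')"
        using linQ \<open>part Q' C'\<close> by (auto simp: part_def linear_subspace_image)
      have "Q x = Q' (Q x)" for x by (simp add: Q'_def QQ Qpq)
      then have "range Q \<subseteq> range Q'" by (metis image_subset_iff rangeI)
      moreover have "p \<in> range Q'"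
      proof -
        have "Q' p = p" using pq Qp by (simp add: Q'_def)
        then show ?thesis by (metis rangeI)
      qed
      moreover have "p \<notin> range Q" using Qpq(1) pq(1) by auto
      ultimately show "span (range Q) \<subset> span (range Q')" using sub by (auto simp: span_eq_iff[THEN iffD2])
    qed
    ultimately show False using k(2)[of "dim (range Q')"] QC(2) by (auto simp: good_def)
  qed
  have "Q x = x" for x using inj[of "x - Q x"] by (simp add: linear_simps QQ)
  then have "norm (C x) = norm x" for x using CQ[of x x] by (simp add: norm_eq)
  then show ?thesis using linC CK by blast
qed

section \<open>Lipschitz minimality of Hopf vector fields\<close>

lemma self_isometry_orthogonal_transformation:
  fixes G :: "'a::euclidean_space \<Rightarrow> 'a"
  assumes G: "orthogonal_transformation G" and "G ` S \<subseteq> S" "inv_into UNIV G ` S \<subseteq> S"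
  shows "self_isometry S (geodesic_dist S) G"
proof -
  have bij: "bij G" and G': "orthogonal_transformation (inv_into UNIV G)"
    using G orthogonal_transformation_bij orthogonal_transformation_inv by blast+
  have "G (inv_into UNIV G x) = x" "inv_into UNIV G (G x) = x" for x
    using bij by (auto simp: bij_def surj_f_inv_f)
  then have "bij_betw G S S"
    using assms(2,3) by (intro bij_betw_byWitness[where f' = "inv_into UNIV G"]) auto
  moreover have "geodesic_dist S (G x) (G y) = geodesic_dist S x y" for x y
    using assms(2,3) G G' \<open>\<And>x. inv_into UNIV G (G x) = x\<close>
    by (intro geodesic_dist_isometric_image[where B = "inv_into UNIV G"])
       (auto simp: orthogonal_transformation)
  ultimately show ?thesis by (simp add: self_isometry_def)
qed

lemma orthogonal_transformation_map_prod:
  fixes A B :: "'a::euclidean_space \<Rightarrow> 'a"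
  assumes "orthogonal_transformation A" "orthogonal_transformation B"
  shows "orthogonal_transformation (map_prod A B)"
proof -
  have "linear A" "linear B" "\<And>x. norm (A x) = norm x" "\<And>x. norm (B x) = norm x"
    using assms by (auto simp: orthogonal_transformation)
  then show ?thesis
    unfolding orthogonal_transformation
    by (auto intro!: linearI simp: linear_add linear_scale norm_prod_def)
qed

lemma inv_map_prod:
  assumes "bij A" "bij B"
  shows "inv_into UNIV (map_prod A B) = map_prod (inv_into UNIV A) (inv_into UNIV B)"
proof (rule inv_equality)
  show "map_prod (inv_into UNIV A) (inv_into UNIV B) (map_prod A B x) = x" for x
    using assms by (cases x) (simp add: bij_is_inj)
  show "map_prod A B (map_prod (inv_into UNIV A) (inv_into UNIV B) x) = x" for x
    using assms by (cases x) (simp add: bij_is_surj surj_f_inv_f)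
qed

text \<open>
  The infimum of the Lipschitz constants is a Lipschitz constant.
\<close>
lemma dist_le_if_Lip_eq_one:
  assumes Lip: "Lip X dX dY f = 1" and x: "x \<in> X" "y \<in> X" and pos: "dX x y \<ge> 0"
  shows "dY (f x) (f y) \<le> dX x y"
proof (rule field_le_epsilon)
  fix e :: real assume e: "e > 0"
  have "Lip X dX dY f < ereal (1 + e / (dX x y + 1))"
    using e pos by (simp add: Lip one_ereal_def)
  then obtain c where c: "c < 1 + e / (dX x y + 1)" "dY (f x) (f y) \<le> c * dX x y"
    unfolding Lip_def Inf_less_iff using x by auto
  have "c * dX x y \<le> (1 + e / (dX x y + 1)) * dX x y"
    using c(1) pos by (intro mult_right_mono) auto
  also have "\<dots> = dX x y + e * (dX x y / (dX x y + 1))" by (simp add: algebra_simps)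
  also have "\<dots> \<le> dX x y + e * 1" using e pos by (intro add_left_mono mult_left_mono) auto
  finally show "dY (f x) (f y) \<le> dX x y + e" using c(2) by simp
qed

lemma hopf_complex_structure:
  assumes "hopf_vector_field (v :: real^'k \<Rightarrow> real^'k)"
  obtains J where "orthogonal_transformation J" "\<And>x. J (J x) = - x" "\<And>x. norm x = 1 \<Longrightarrow> v x = J x"
proof -
  obtain M :: "real^'k^'k" where M: "rotation_matrix M" "M ** M = - mat 1" "\<And>x. norm x = 1 \<Longrightarrow> v x = M *v x"
    using assms by (auto simp: hopf_vector_field_def)
  have "M *v (M *v x) = - x" for x
  proof -
    have "M *v (M *v x) = (- mat 1) *v x" by (simp add: matrix_vector_mul_assoc M(2))
    also have "\<dots> = - (mat 1 *v x)"
      by (simp add: vec_eq_iff matrix_vector_mult_def sum_negf)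
    also have "\<dots> = - x" by simp
    finally show ?thesis .
  qed
  moreover have "orthogonal_transformation ((*v) M)"
    using M(1) by (simp add: rotation_matrix_def orthogonal_transformation_matrix)
  ultimately show thesis using that[of "(*v) M"] M(3) by blast
qed

theorem theoremC:
  fixes n :: nat
    and v :: "real^'k \<Rightarrow> real^'k"
    and VS US :: "((real^'k) \<times> (real^'k)) set"
    and f :: "(real^'k) \<times> (real^'k) \<Rightarrow> (real^'k) \<times> (real^'k)"
  assumes "n \<ge> 1"
    and "CARD('k) = 2 * n + 2"
    and "hopf_vector_field v"
    and "VS = vector_field_section v ` sphere 0 1"
    and "US = unit_tangent_bundle"
    and "continuous_on VS f" and "f ` VS \<subseteq> US"
    and "homotopic_with_canon (\<lambda>_. True) VS US f (\<lambda>p. p)"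
  shows "Lip VS (geodesic_dist VS) (geodesic_dist US) f \<ge> 1 \<and>
    (Lip VS (geodesic_dist VS) (geodesic_dist US) f = 1 \<longleftrightarrow>
      isometric_maps VS (geodesic_dist VS) US (geodesic_dist US) f (\<lambda>p. p))"
proof -
  obtain J where orthJ: "orthogonal_transformation J" and JJ: "\<And>x. J (J x) = - x"
    and vJ: "\<And>x. norm x = 1 \<Longrightarrow> v x = J x"
    using hopf_complex_structure[OF assms(3)] by metis
  have linJ: "linear J" "\<And>x. norm (J x) = norm x" using orthJ by (auto simp: orthogonal_transformation)
  have dims: "DIM(real^'k) \<ge> 3" "DIM(real^'k) \<ge> 2" using assms(1,2) by auto
  define V where "V x = (x, J x)" for x :: "real^'k"
  have VS: "VS = V ` sphere 0 1"
    using vJ unfolding assms(4) V_def vector_field_section_def by (intro image_cong) auto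
  have J_inner: "J x \<bullet> y = - (x \<bullet> J y)" for x y
    using orthJ JJ by (metis inner_minus_right minus_minus orthogonal_transformation_def)
  have xJx: "x \<bullet> J x = 0" for x using J_inner[of x x] by (simp add: inner_commute)
  have VU: "VS \<subseteq> US" by (auto simp: VS assms(5) V_def unit_tangent_bundle_def linJ(2) xJx)
  have US_sub: "US \<subseteq> sphere_product" by (auto simp: assms(5) unit_tangent_bundle_def)
  have contV: "continuous_on A V" for A
    unfolding V_def using linJ(1) by (intro continuous_intros linear_continuous_on) (auto simp: linear_conv_bounded_linear)
  define g1 where "g1 x = fst (f (V x))" for x
  define g2 where "g2 x = snd (f (V x))" for x
  have fV: "f (V x) = (g1 x, g2 x)" for x by (simp add: g1_def g2_def)
  have fU: "(g1 x, g2 x) \<in> US" if "norm x = 1" for x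
  proof -
    have "V x \<in> VS" using that by (simp add: VS)
    then have "f (V x) \<in> US" using assms(7) by blast
    then show ?thesis by (simp add: fV)
  qed
  have hom: "homotopic_with_canon (\<lambda>_. True) (sphere 0 1) US (f \<circ> V) ((\<lambda>p. p) \<circ> V)"
    by (rule homotopic_with_compose_continuous_right[OF assms(8) contV]) (auto simp: VS)
  have "homotopic_with_canon (\<lambda>_. True) (sphere 0 1) (sphere 0 1) (fst \<circ> (f \<circ> V)) (fst \<circ> ((\<lambda>p. p) \<circ> V))"
    by (rule homotopic_with_compose_continuous_left[OF hom])
       (use US_sub in \<open>auto intro!: continuous_intros\<close>)
  then have g1_id: "homotopic_with_canon (\<lambda>_. True) (sphere 0 1) (sphere 0 1) g1 id"
    by (rule homotopic_with_eq) (auto simp: g1_def V_def)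
  have "homotopic_with_canon (\<lambda>_. True) (sphere 0 1) (sphere 0 1) (snd \<circ> (f \<circ> V)) (snd \<circ> ((\<lambda>p. p) \<circ> V))"
    by (rule homotopic_with_compose_continuous_left[OF hom])
       (use US_sub in \<open>auto intro!: continuous_intros\<close>)
  then have "homotopic_with_canon (\<lambda>_. True) (sphere 0 1) (sphere 0 1) g2 J"
    by (rule homotopic_with_eq) (auto simp: g2_def V_def)
  moreover have "homotopic_with_canon (\<lambda>_. True) (sphere 0 1) (sphere 0 1) J id"
    using complex_structure_rotation_homotopic_id[OF linJ(1) JJ J_inner, of "pi / 2"] by simp
  ultimately have g2_id: "homotopic_with_canon (\<lambda>_. True) (sphere 0 1) (sphere 0 1) g2 id"
    by (rule homotopic_with_trans)
  interpret frame_map g1 g2 J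
    using fU linJ JJ J_inner g1_id g2_id by unfold_locales (auto simp: assms(5) unit_tangent_bundle_def linear_add linear_scale)
  have arc: "sqrt 2 * angle x y \<in> curve_lengths VS (V x) (V y)" if "norm x = 1" "norm y = 1" for x y
    using graph_curve_length[OF dims(2) linJ that] by (simp add: VS V_def[abs_def])
  have dV: "geodesic_dist VS (V x) (V y) \<le> sqrt 2 * angle x y" "0 \<le> geodesic_dist VS (V x) (V y)"
    if "norm x = 1" "norm y = 1" for x y
    using geodesic_dist_le[OF arc[OF that]] geodesic_dist_nonneg[of VS "V x" "V y"] arc[OF that] by auto
  have dU: "product_angle P Q \<le> geodesic_dist US P Q" if "P \<in> US" "Q \<in> US" for P Q
    using product_angle_le_geodesic_dist[OF curve_lengths_unit_tangent_bundle_nonempty[OF dims(1)]] that US_sub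
    unfolding assms(5) by blast
  have shorter: "(angle (g1 x) (g1 y))\<^sup>2 + (angle (g2 x) (g2 y))\<^sup>2 \<le> 2 * (c * angle x y)\<^sup>2"
    if xy: "norm x = 1" "norm y = 1" and c: "0 \<le> c"
      and le: "geodesic_dist US (f (V x)) (f (V y)) \<le> c * geodesic_dist VS (V x) (V y)" for x y c
  proof -
    have "sqrt ((angle (g1 x) (g1 y))\<^sup>2 + (angle (g2 x) (g2 y))\<^sup>2) = product_angle (f (V x)) (f (V y))"
      by (simp add: product_angle_def fV)
    also have "\<dots> \<le> geodesic_dist US (f (V x)) (f (V y))"
      using fU xy by (intro dU) (auto simp: fV)
    also have "\<dots> \<le> c * (sqrt 2 * angle x y)"
      using le mult_left_mono[OF dV(1)[OF xy] c] by linarith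
    finally have "(angle (g1 x) (g1 y))\<^sup>2 + (angle (g2 x) (g2 y))\<^sup>2 \<le> (c * (sqrt 2 * angle x y))\<^sup>2"
      by (rule sqrt_le_D)
    then show ?thesis by (simp add: power_mult_distrib)
  qed
  have ge: "Lip VS (geodesic_dist VS) (geodesic_dist US) f \<ge> 1"
    unfolding Lip_def
  proof (rule Inf_greatest, clarify)
    fix c :: real
    assume c: "0 \<le> c" "\<forall>x\<in>VS. \<forall>x'\<in>VS. geodesic_dist US (f x) (f x') \<le> c * geodesic_dist VS x x'"
    have "1 \<le> c"
      by (rule Lipschitz_constant_ge_one[OF c(1) shorter[OF _ _ c(1)]]) (use c(2) in \<open>auto simp: VS\<close>)
    then show "1 \<le> ereal c" by (simp add: one_ereal_def)
  qed
  moreover have "isometric_maps VS (geodesic_dist VS) US (geodesic_dist US) f (\<lambda>p. p)"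
    if Lip: "Lip VS (geodesic_dist VS) (geodesic_dist US) f = 1"
  proof -
    have "geodesic_dist US (f (V x)) (f (V y)) \<le> 1 * geodesic_dist VS (V x) (V y)"
      if "norm x = 1" "norm y = 1" for x y
      using dist_le_if_Lip_eq_one[OF Lip] dV(2)[OF that] that by (simp add: VS)
    then have "short_frame_map g1 g2 J"
      using shorter[of _ _ 1] by unfold_locales auto
    then interpret short_frame_map g1 g2 J .
    obtain K A where K: "linear K" "\<And>x. K (K x) = - x" "\<And>x y. K x \<bullet> y = - (x \<bullet> K y)"
      and A: "linear A" "\<And>x. norm (A x) = norm x"
      and g: "\<And>x. norm x = 1 \<Longrightarrow> g1 x = A x" "\<And>x. norm x = 1 \<Longrightarrow> g2 x = A (K x)"
      using linear_frame_map by blast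
    obtain C where C: "linear C" "\<And>x. norm (C x) = norm x" "\<And>x. C (K x) = J (C x)"
      using orthogonal_complex_structures_conjugate[OF linJ(1) JJ J_inner K] by blast
    have orthA: "orthogonal_transformation A" and orthC: "orthogonal_transformation C"
      using A C by (auto simp: orthogonal_transformation)
    \<comment> \<open>\<open>D\<close> carries \<open>(A x, A (K x))\<close> to \<open>(C x, C (K x)) = (C x, J (C x))\<close>, the value of the section at \<open>C x\<close>.\<close>
    define D where "D = C \<circ> inv_into UNIV A"
    have orthD: "orthogonal_transformation D"
      unfolding D_def by (intro orthogonal_transformation_compose orthC orthogonal_transformation_inv orthA)
    have DA: "D (A x) = C x" for x
      using orthogonal_transformation_bij[OF orthA] by (simp add: D_def bij_is_inj)
    \<comment> \<open>On the image of the section \<open>(C, B)\<close> is the map induced by \<open>C\<close>, in a form that is orthogonal on the whole space.\<close>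
    define B where "B = J \<circ> C \<circ> inv_into UNIV J"
    have orthB: "orthogonal_transformation B"
      unfolding B_def by (intro orthogonal_transformation_compose orthC orthJ orthogonal_transformation_inv)
    have BJ: "B (J x) = J (C x)" for x
      using orthogonal_transformation_bij[OF orthJ] by (simp add: B_def bij_is_inj)
    have BJ': "inv_into UNIV B (J x) = J (inv_into UNIV C x)" for x
      using BJ[of "inv_into UNIV C x"] orthogonal_transformation_bij[OF orthB] orthogonal_transformation_bij[OF orthC]
      by (metis bij_inv_eq_iff)
    have nC': "norm (inv_into UNIV C x) = norm x" for x
      using orthogonal_transformation_inv[OF orthC] by (simp add: orthogonal_transformation)
    have "self_isometry VS (geodesic_dist VS) (map_prod C B)"
    proof (rule self_isometry_orthogonal_transformation)
      show "map_prod C B ` VS \<subseteq> VS"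
        by (auto simp: VS V_def BJ C(2))
      show "inv_into UNIV (map_prod C B) ` VS \<subseteq> VS"
        using orthogonal_transformation_bij[OF orthB] orthogonal_transformation_bij[OF orthC]
        by (auto simp: VS V_def BJ' nC' inv_map_prod)
    qed (intro orthogonal_transformation_map_prod orthC orthB)
    moreover have "self_isometry US (geodesic_dist US) (map_prod D D)"
    proof (rule self_isometry_orthogonal_transformation)
      have US_im: "map_prod T T ` US \<subseteq> US" if "orthogonal_transformation T" for T
        using that by (auto simp: assms(5) unit_tangent_bundle_def orthogonal_transformation_norm orthogonal_transformation_def norm_eq_sqrt_inner)
      show "map_prod D D ` US \<subseteq> US" "inv_into UNIV (map_prod D D) ` US \<subseteq> US"
        using US_im[OF orthD] US_im[OF orthogonal_transformation_inv[OF orthD]]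
          orthogonal_transformation_bij[OF orthD] by (auto simp: inv_map_prod)
    qed (intro orthogonal_transformation_map_prod orthD)
    moreover have "map_prod D D (f z) = map_prod C B z" if "z \<in> VS" for z
      using that by (auto simp: VS fV g DA C(3)) (simp add: V_def BJ)
    ultimately show ?thesis unfolding isometric_maps_def by blast
  qed
  moreover have "Lip VS (geodesic_dist VS) (geodesic_dist US) f \<le> 1"
    if iso: "isometric_maps VS (geodesic_dist VS) US (geodesic_dist US) f (\<lambda>p. p)"
  proof -
    obtain gX gY where gX: "self_isometry VS (geodesic_dist VS) gX" and gY: "self_isometry US (geodesic_dist US) gY"
      and eq: "\<And>x. x \<in> VS \<Longrightarrow> gY (f x) = gX x"
      using iso unfolding isometric_maps_def by blast
    have "geodesic_dist US (f x) (f y) \<le> geodesic_dist VS x y" if "x \<in> VS" "y \<in> VS" for x y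
    proof -
      have "geodesic_dist US (f x) (f y) = geodesic_dist US (gY (f x)) (gY (f y))"
        using gY assms(7) that unfolding self_isometry_def by (metis image_subset_iff)
      also have "\<dots> = geodesic_dist US (gX x) (gX y)" by (simp add: eq that)
      also have "\<dots> \<le> geodesic_dist VS (gX x) (gX y)"
      proof (rule geodesic_dist_antimono[OF VU])
        have "gX x \<in> VS" "gX y \<in> VS"
          using gX that by (auto simp: self_isometry_def bij_betw_def)
        then obtain a b where "gX x = V a" "gX y = V b" "norm a = 1" "norm b = 1"
          by (auto simp: VS)
        then show "curve_lengths VS (gX x) (gX y) \<noteq> {}" using arc[of a b] by auto
      qed
      also have "\<dots> = geodesic_dist VS x y" using gX that by (simp add: self_isometry_def)
      finally show ?thesis .
    qed
    then show ?thesis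
      unfolding Lip_def by (intro Inf_lower) (auto intro!: exI[of _ 1] simp: one_ereal_def)
  qed
  ultimately show ?thesis by (meson antisym)
qed

end
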